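(* There is a (randomized) online algorithm for the edge-weighted online bipartite matching problem in the free-disposal model that is $0.514$-competitive: for every instance, the expected total weight of the solution it produces is at least $0.514$ times the weight of a maximum-weight matching of the instance.
   Context: Edge-weighted online bipartite matching with free disposal: there is a bipartite graph with offline vertex set $L$ (known upfront) and online vertex set $R$, and every pair $(i,j)\in L\times R$ has a nonnegative weight $w_{ij}\ge 0$ (missing edges have weight $0$). The vertices $j\in R$ arrive one at a time; when $j$ arrives, the weights $w_{ij}$ for all $i\in L$ are revealed, and the algorithm must immediately and irrevocably either match $j$ to some $i\in L$ or leave $j$ unmatched. An offline vertex may be matched to any number of online vertices, but only the heaviest edge matched to it counts: the objective value is $\sum_{i\in L}\max\{w_{ij} : j \text{ matched to } i\}$ (with the maximum over the empty set equal to $0$). An online algorithm is $\Gamma$-competitive if on every instance its expected objective is at least $\Gamma$ times the offline optimum, i.e., the maximum total weight of a matching in the complete bipartite graph $L\times R$ with weights $w_{ij}$. *)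

theory Defs
  imports "HOL-Probability.Probability"
begin

text \<open>
  The online vertices of an instance are the positions \<open>0, \<dots>, n - 1\<close> of a list \<open>ws\<close>, in order of
  arrival; \<open>(ws ! j) i\<close> is the weight \<open>w\<^sub>i\<^sub>j\<close> of the edge between \<open>i \<in> L\<close> and the online
  vertex \<open>j\<close>. Values of \<open>ws ! j\<close> outside \<open>L\<close> are unconstrained and enter neither the objective nor
  the optimum.
\<close>

definition instance_ok :: "'v set \<Rightarrow> ('v \<Rightarrow> real) list \<Rightarrow> bool" where
  "instance_ok L ws \<longleftrightarrow> finite L \<and> (\<forall>w\<in>set ws. \<forall>i\<in>L. 0 \<le> w i)"

definition is_matching :: "'v set \<Rightarrow> nat \<Rightarrow> ('v \<times> nat) set \<Rightarrow> bool" where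
  "is_matching L n M \<longleftrightarrow> M \<subseteq> L \<times> {..<n} \<and> inj_on fst M \<and> inj_on snd M"

definition matching_weight :: "('v \<Rightarrow> real) list \<Rightarrow> ('v \<times> nat) set \<Rightarrow> real" where
  "matching_weight ws M = (\<Sum>(i, j)\<in>M. (ws ! j) i)"

definition offline_opt :: "'v set \<Rightarrow> ('v \<Rightarrow> real) list \<Rightarrow> real" where
  "offline_opt L ws = Max (matching_weight ws ` {M. is_matching L (length ws) M})"

text \<open>
  \<open>ds ! j\<close> is the offline vertex to which \<open>j\<close> is matched (\<open>None\<close> if \<open>j\<close> is left unmatched).
  Weights being nonnegative, inserting \<open>0\<close> only fixes the maximum over the empty set.
\<close>

definition free_disposal_value ::
  "'v set \<Rightarrow> ('v \<Rightarrow> real) list \<Rightarrow> 'v option list \<Rightarrow> real" where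
  "free_disposal_value L ws ds =
     (\<Sum>i\<in>L. Max (insert 0 {(ws ! j) i | j. j < length ws \<and> ds ! j = Some i}))"

text \<open>
  In each step a randomized online algorithm produces a private random signal (of type \<open>'s\<close>)
  together with a decision. The joint distribution of the two may depend on the offline vertices,
  on the weight vectors revealed so far (the last one being that of the arriving vertex), and on
  the signals and decisions of all previous steps. The signals are the random bits the algorithm
  remembers without revealing them through its decisions.
\<close>

type_synonym ('v, 's) online_alg =
  "'v set \<Rightarrow> ('v \<Rightarrow> real) list \<Rightarrow> ('s \<times> 'v option) list \<Rightarrow> ('s \<times> 'v option) pmf"

definition valid_online_alg :: "('v, 's) online_alg \<Rightarrow> bool" where
  "valid_online_alg A \<longleftrightarrow>
     (\<forall>L ws h. finite L \<longrightarrow> snd ` set_pmf (A L ws h) \<subseteq> insert None (Some ` L))"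

primrec run_steps ::
  "('v, 's) online_alg \<Rightarrow> 'v set \<Rightarrow> ('v \<Rightarrow> real) list \<Rightarrow> nat \<Rightarrow> ('s \<times> 'v option) list pmf" where
  "run_steps A L ws 0 = return_pmf []"
| "run_steps A L ws (Suc k) =
     bind_pmf (run_steps A L ws k)
       (\<lambda>h. map_pmf (\<lambda>x. h @ [x]) (A L (take (Suc k) ws) h))"

definition decisions ::
  "('v, 's) online_alg \<Rightarrow> 'v set \<Rightarrow> ('v \<Rightarrow> real) list \<Rightarrow> 'v option list pmf" where
  "decisions A L ws = map_pmf (map snd) (run_steps A L ws (length ws))"

definition competitive :: "real \<Rightarrow> ('v, 's) online_alg \<Rightarrow> bool" where
  "competitive \<Gamma> A \<longleftrightarrow>
     (\<forall>L ws. instance_ok L ws \<longrightarrow>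
        measure_pmf.expectation (decisions A L ws) (free_disposal_value L ws)
          \<ge> \<Gamma> * offline_opt L ws)"

end

theory Submission
  imports Defs
begin

text \<open>
  The algorithm spreads each online vertex fractionally over the offline vertices and rounds with
  negative correlation. For the rounding, every vertex (and a dummy \<open>None\<close>, which stands for staying
  unmatched) carries a random bit. In each step a first and a second candidate are drawn independently
  from the allocation; the first one is selected with probability \<open>17/20\<close> if its bit is boosted and
  \<open>3/20\<close> otherwise, the second one replaces it if it is rejected, and a vertex becomes boosted exactly
  when it is rejected. A vertex therefore tends to be selected every second time it is drawn first,
  which makes it less likely than under independent rounding to remain unselected in a run of steps.
  The selections as a second candidate depend on the bits of the other vertices; the resulting positive
  correlation is of second order in the mass of a vertex, and is paid for by the difference between
  \<open>1 - x\<close> and \<open>exp (- x)\<close>.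

  For each offline vertex \<open>i\<close> and level \<open>l > 0\<close>, a pair of numbers bounds the probabilities that \<open>i\<close>
  has not yet received an edge of weight at least \<open>l\<close> and that its bit is boosted, respectively not
  boosted. The pair evolves linearly: by one matrix if the weight of the current edge reaches \<open>l\<close>,
  and by the mixing of the bit otherwise. Hence the primal-dual method applies with a dual variable
  of \<open>i\<close> that is the integral over all levels of \<open>0.514\<close> minus a fixed linear functional of the pair,
  when the mass of an online vertex is given in portions of \<open>1/1000\<close> to the vertex \<open>i\<close> for which
  \<open>0.514 w\<^sub>i\<^sub>j\<close> exceeds the dual variable most.
\<close>

section \<open>Numerical inequalities\<close>

text \<open>
  Entries of the matrix that bounds the effect of one step, in which a vertex has mass \<open>x\<close> and its
  selection is to be avoided, on the pair (probability of being still unselected and boosted,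
  probability of being still unselected and not boosted). The term \<open>(1 - x) * (1 - x/2 + 2/5 * x\<^sup>2)\<close>
  contained in both diagonal entries is the case that another vertex is sampled first; its part
  \<open>2/5 * x\<^sup>2\<close> pays for the correlation between the bits of different vertices.
\<close>

definition boosted_stay :: "real \<Rightarrow> real" where "boosted_stay x = (1 - x) * (1 - 7/20 * x + 23/40 * x^2)"
definition plain_stay :: "real \<Rightarrow> real" where "plain_stay x = (1 - x) * (1 - 1/2 * x + 13/20 * x^2)"
definition plain_to_boosted :: "real \<Rightarrow> real" where "plain_to_boosted x = 17/20 * (1 - x) * (x - x^2 / 2)"
definition chain_prob :: "real \<Rightarrow> real" where "chain_prob x = x - x^2 / 2"

text \<open>
  The price of conditioning the bit of another vertex to have mean \<open>e\<close>. The asymmetry is essential: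
  the bits alternate with correlation \<open>- 7/10\<close> (and \<open>49/100 = (7/10)\<^sup>2\<close>), so a positive bias, which is
  harmful now, turns into a beneficial one after the next use of the bit.
\<close>

definition bias_factor :: "real \<Rightarrow> real" where "bias_factor e = (if 0 \<le> e then 1 + e^2 else 1 + 49/100 * e^2)"

lemma quadratic_form_nonneg:
  fixes p q r x e :: real
  assumes "0 < p" "q^2 \<le> 4 * p * r"
  shows "0 \<le> p * x^2 - q * x * e + r * e^2"
proof -
  have "4 * p * (p * x^2 - q * x * e + r * e^2) = (2 * p * x - q * e)^2 + (4 * p * r - q^2) * e^2"
    by (simp add: power2_eq_square algebra_simps)
  also have "\<dots> \<ge> 0" using assms(2) by simp
  finally show ?thesis using assms(1) by (simp add: zero_le_mult_iff)
qed

text \<open>\<open>A\<close> is the probability that the tracked vertex, of mass \<open>x\<close>,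
  survives a step in which another vertex, whose bit has mean \<open>e\<close>, is drawn first and
  its bit is used. \<open>d\<close> is the mean of the new bit restricted to that event, so
  \<open>d / A\<close> is its conditional mean. The price of the new bias is covered by the old
  price and the extra \<open>2/5 * x^2\<close>.\<close>

lemma bias_factor_step:
  fixes x e :: real
  assumes x: "0 \<le> x" "x \<le> 1" and e: "-1 \<le> e" "e \<le> 1"
  defines "A \<equiv> 1 - x / 2 + 7/20 * x * e"
    and "d \<equiv> - 7/10 * e * (1 - x / 2) - x / 2"
  shows "0 < A" "\<bar>d / A\<bar> \<le> 1" "A * bias_factor (d / A) \<le> (1 - x / 2 + 2/5 * x^2) * bias_factor e"
proof -
  define h where "h = 1 - x / 2"
  have h: "1/2 \<le> h" "h \<le> 1" "x = 2 - 2 * h" using x by (auto simp: h_def)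
  show A0: "0 < A"
  proof -
    have "x * e \<ge> -x" using x e mult_left_mono[of "-1" e x] by simp
    then show ?thesis using x by (simp add: A_def)
  qed
  \<comment> \<open>Twice the surviving mass with the drawn vertex selected (new bit -1) and with it
    rejected (new bit +1).\<close>
  have "A - d = (1 + 7/10 * e)" "A + d = (1 - 7/10 * e) * (1 - x)"
    by (simp_all add: A_def d_def field_simps)
  moreover have "0 \<le> (1 + 7/10 * e)" "0 \<le> (1 - 7/10 * e) * (1 - x)" using x e by simp_all
  ultimately have "\<bar>d\<bar> \<le> A" by linarith
  then show "\<bar>d / A\<bar> \<le> 1" using A0 by (simp add: divide_le_eq)
  \<comment> \<open>Multiplication by \<open>A\<close> clears the fraction; \<open>c\<close> is the
    coefficient that \<open>bias_factor\<close> assigns to the sign of \<open>d\<close>.\<close>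
  have main: "A^2 + c * d^2 \<le> (1 - x / 2 + 2/5 * x^2) * bias_factor e * A \<Longrightarrow> bias_factor (d / A) = 1 + c * (d / A)^2
    \<Longrightarrow> A * bias_factor (d / A) \<le> (1 - x / 2 + 2/5 * x^2) * bias_factor e" for c
  proof -
    assume a: "A^2 + c * d^2 \<le> (1 - x / 2 + 2/5 * x^2) * bias_factor e * A" and b: "bias_factor (d / A) = 1 + c * (d / A)^2"
    have "(A * bias_factor (d / A)) * A = A^2 + c * d^2"
      using A0 by (simp add: b power2_eq_square field_simps)
    then show ?thesis using a A0 by (metis mult_le_cancel_right_pos)
  qed
  define rho where "rho = h + 2/5 * x^2"
  have rho: "rho \<le> 1" "h \<le> rho"
  proof -
    have "x^2 \<le> x" using x by (simp add: power2_eq_square mult_left_le)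
    then show "rho \<le> 1" using x by (simp add: rho_def h_def)
  qed (simp add: rho_def)
  consider "0 \<le> e" | "e < 0" "0 \<le> d" | "e < 0" "d < 0" by linarith
  then show "A * bias_factor (d / A) \<le> (1 - x / 2 + 2/5 * x^2) * bias_factor e"
  proof cases
    case 1
    have "0 \<le> e * (1 - x / 2)" using 1 x by simp
    moreover have "d = - (7/10 * (e * (1 - x / 2))) - x / 2" by (simp add: d_def)
    ultimately have dn: "d \<le> 0" using x by linarith
    have c: "bias_factor (d / A) = 1 + 49/100 * (d / A)^2"
      using dn A0 by (auto simp: bias_factor_def divide_le_0_iff zero_le_divide_iff)
    have q0: "0 \<le> 2/5 * x^2 - 7/20 * x * e + rho * e^2"
      using quadratic_form_nonneg[of "2/5" "7/20" rho x e] rho h by (simp add: power2_eq_square)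
    \<comment> \<open>For \<open>e \<ge> 0\<close> the factor \<open>A\<close> is at least
      \<open>h\<close>. Replacing it leaves a quadratic form in \<open>x\<close> and
      \<open>e\<close>, decided by its discriminant.\<close>
    have r: "0 \<le> (2/5 * h - 49/400) * x^2 - (693/1000 * h) * x * e + (h * (rho - 2401/10000 * h)) * e^2"
    proof (rule quadratic_form_nonneg)
      show "0 < 2/5 * h - 49/400" using h by simp
      have "(693/1000)^2 * h \<le> 4 * (2/5 * h - 49/400) * (rho - 2401/10000 * h)"
      proof -
        have rh: "rho = h + 8/5 * (1 - h)^2" by (simp add: rho_def h(3) power2_eq_square algebra_simps)
        define t where "t = h - 1/2"
        have t: "0 \<le> t" "t \<le> 1/2" using h by (auto simp: t_def)
        \<comment> \<open>The slack is least at \<open>t = 0\<close>, that is at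
          \<open>x = 1\<close>, where only \<open>83/50000\<close> remains of what the coefficient
          \<open>2/5\<close> provides.\<close>
        have "4 * (2/5 * h - 49/400) * (rho - 2401/10000 * h) - (693/1000)^2 * h =
          83/50000 + t * (50724/100000 - 84816/100000 * t) + 64/25 * t^3"
          unfolding rh by (simp add: t_def field_simps power2_eq_square power3_eq_cube)
        moreover have "0 \<le> t * (50724/100000 - 84816/100000 * t)" using t by simp
        moreover have "0 \<le> t^3" using t by simp
        ultimately show ?thesis by linarith
      qed
      then have "h * ((693/1000)^2 * h) \<le> h * (4 * (2/5 * h - 49/400) * (rho - 2401/10000 * h))"
        using h by (intro mult_left_mono) auto
      then show "(693/1000 * h)^2 \<le> 4 * (2/5 * h - 49/400) * (h * (rho - 2401/10000 * h))"
        by (simp add: power2_eq_square algebra_simps)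
    qed
    have Ah: "A = h + 7/20 * x * e" "d = - (7/10 * e * h + x / 2)" by (simp_all add: A_def d_def h_def)
    have "h * (2/5 * x^2 - 7/20 * x * e + rho * e^2) \<le> A * (2/5 * x^2 - 7/20 * x * e + rho * e^2)"
      using q0 x 1 by (intro mult_right_mono) (auto simp: Ah)
    moreover have "(1 - x / 2 + 2/5 * x^2) * bias_factor e * A - A^2 - 49/100 * d^2
       = A * (2/5 * x^2 - 7/20 * x * e + rho * e^2) - 49/100 * (7/10 * e * h + x / 2)^2"
      using 1 by (simp add: bias_factor_def Ah rho_def h_def power2_eq_square field_simps)
    moreover have "h * (2/5 * x^2 - 7/20 * x * e + rho * e^2) - 49/100 * (7/10 * e * h + x / 2)^2 =
       (2/5 * h - 49/400) * x^2 - (693/1000 * h) * x * e + (h * (rho - 2401/10000 * h)) * e^2"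
      by (simp add: power2_eq_square field_simps)
    ultimately have "A^2 + 49/100 * d^2 \<le> (1 - x / 2 + 2/5 * x^2) * bias_factor e * A" using r by linarith
    then show ?thesis by (rule main[OF _ c])
  next
    case 2
    define a where "a = - e"
    have a: "0 \<le> a" "a \<le> 1" using 2 e by (auto simp: a_def)
    have c: "bias_factor (d / A) = 1 + 1 * (d / A)^2" using 2 A0 by (simp add: bias_factor_def)
    have Ah: "A = h - 7/20 * x * a" "d = 7/10 * a * h - x / 2" by (simp_all add: A_def d_def h_def a_def)
    have d0: "x / 2 \<le> 7/10 * a * h" using 2 Ah by simp
    \<comment> \<open>As \<open>d \<ge> 0\<close>, one factor \<open>x / 2\<close> may be exchanged
      for \<open>7/10 * a * h\<close>. The leading term of the bound for \<open>d^2\<close> is then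
      \<open>49/100 * a^2 * h^2\<close>, which is matched by the price \<open>49/100 * e^2\<close>
      of a negative bias.\<close>
    have "x / 2 * (x / 2) \<le> (7/10 * a * h) * (x/2)" using d0 x by (intro mult_right_mono) auto
    then have d2: "d^2 \<le> (49/100 * a^2 * h^2) - 7/20 * a * h * x"
      by (simp add: Ah power2_eq_square field_simps)
    have "rho * a^2 \<le> 1" using rho h a by (intro mult_le_one) (auto simp: power_le_one)
    then have "0 \<le> A + h - 49/100 * (rho * a^2)" using A0 h by linarith
    then have "0 \<le> (7/20 * x * a) * (A + h - 49/100 * (rho * a^2))" using x a by simp
    moreover have "0 \<le> A * (2/5 * x^2) + 49/100 * a^2 * (2/5 * x^2 * h)" using A0 x h a by simp
    moreover have "(1 - x / 2 + 2/5 * x^2) * bias_factor e * A - A^2 - ((49/100 * a^2 * h^2) - 7/20 * a * h * x)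
      = (A * (2/5 * x^2) + 49/100 * a^2 * (2/5 * x^2 * h)) + (7/20 * x * a) * (A + h - 49/100 * (rho * a^2))"
      using 2 by (simp add: bias_factor_def Ah a_def rho_def h_def power2_eq_square field_simps)
    ultimately have "A^2 + 1 * d^2 \<le> (1 - x / 2 + 2/5 * x^2) * bias_factor e * A" using d2 by linarith
    then show ?thesis by (rule main[OF _ c])
  next
    case 3
    define a where "a = - e"
    have a: "0 \<le> a" "a \<le> 1" using 3 e by (auto simp: a_def)
    have c: "bias_factor (d / A) = 1 + 49/100 * (d / A)^2"
      using 3 A0 by (auto simp: bias_factor_def zero_le_divide_iff)
    have Ah: "A = h - 7/20 * x * a" "d = 7/10 * a * h - x / 2" by (simp_all add: A_def d_def h_def a_def)
    have d0: "7/10 * a * h \<le> x / 2" using 3 Ah by simp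
    have "7/10 * a * h * (7/10 * a * h) \<le> (7/10 * a * h) * (x/2)" using d0 a h by (intro mult_left_mono) auto
    then have d2: "d^2 \<le> x^2 / 4 - 7/20 * a * h * x"
      by (simp add: Ah power2_eq_square field_simps)
    have e1: "49/100 * d^2 \<le> 49/400 * x^2 - 343/2000 * (a * h * x)" using d2 by simp
    have e2: "x^2 * x * a \<le> x^2 * a" using x a by (simp add: mult_right_mono mult_left_le)
    have e3: "x^2 * a \<le> x^2" using x a by (simp add: mult_left_le)
    have e4: "x^2 * a \<le> x * a" using x a by (simp add: power2_eq_square mult_right_mono mult_left_le)
    have e5: "(1/2) * (x * a) \<le> a * h * x"
      using mult_right_mono[of "1/2" h "x * a"] h a x by (simp add: mult_ac)
    have e6: "(1/2) * x^2 \<le> h * x^2" using h by (intro mult_right_mono) auto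
    have e8: "0 \<le> x^2" "0 \<le> x * a" using x a by auto
    have e7: "0 \<le> A * (7/20 * x * a + 49/100 * rho * a^2)" using A0 x a rho h by simp
    have "(1 - x / 2 + 2/5 * x^2) * bias_factor e * A - A^2
      = 2/5 * (h * x^2) - 7/50 * (x^2 * x * a) + A * (7/20 * x * a + 49/100 * rho * a^2)"
      using 3 by (simp add: bias_factor_def Ah a_def rho_def h_def power2_eq_square field_simps)
    then have "A^2 + 49/100 * d^2 \<le> (1 - x / 2 + 2/5 * x^2) * bias_factor e * A"
      using e1 e2 e3 e4 e5 e6 e7 e8 by linarith
    then show ?thesis by (rule main[OF _ c])
  qed
qed

section \<open>Signs and monotonicity of the matrix entries\<close>

lemma boosted_stay_nonneg: "0 \<le> x \<Longrightarrow> x \<le> 1 \<Longrightarrow> 0 \<le> boosted_stay x"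
  unfolding boosted_stay_def by (intro mult_nonneg_nonneg add_nonneg_nonneg) auto

lemma plain_stay_nonneg: "0 \<le> x \<Longrightarrow> x \<le> 1 \<Longrightarrow> 0 \<le> plain_stay x"
  unfolding plain_stay_def by (intro mult_nonneg_nonneg add_nonneg_nonneg) auto

lemma chain_prob_nonneg: "0 \<le> x \<Longrightarrow> x \<le> 1 \<Longrightarrow> 0 \<le> chain_prob x"
  using mult_left_le[of x x] by (simp add: chain_prob_def power2_eq_square)

text \<open>\<open>chain_prob x\<close> is the probability that the bit of a vertex of mass
  \<open>x\<close> is used: the vertex is drawn first, with probability \<open>x\<close>, and no
  fair coin replaces its bit, with probability \<open>1 - x / 2\<close>.\<close>

lemma chain_prob_le_half: "chain_prob x \<le> 1/2"
proof -
  have "1/2 - chain_prob x = (1 - x)^2 / 2" by (simp add: chain_prob_def power2_eq_square field_simps)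
  also have "\<dots> \<ge> 0" by simp
  finally show ?thesis by simp
qed

lemma plain_to_boosted_eq: "plain_to_boosted x = 17/20 * (1 - x) * chain_prob x"
  by (simp add: plain_to_boosted_def chain_prob_def)

lemma plain_to_boosted_nonneg: "0 \<le> x \<Longrightarrow> x \<le> 1 \<Longrightarrow> 0 \<le> plain_to_boosted x"
  by (simp add: plain_to_boosted_eq chain_prob_nonneg)

lemma plain_stay_le_boosted_stay:
  assumes "0 \<le> x" "x \<le> 1" shows "plain_stay x \<le> boosted_stay x"
proof -
  have "boosted_stay x - plain_stay x = (1 - x) * (3/20 * chain_prob x)"
    by (simp add: boosted_stay_def plain_stay_def chain_prob_def power2_eq_square field_simps)
  also have "\<dots> \<ge> 0" using assms chain_prob_nonneg[of x] by simp
  finally show ?thesis by simp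
qed

lemma boosted_stay_plain_to_boosted_le_1:
  assumes "0 \<le> x" "x \<le> 1" shows "boosted_stay x + plain_to_boosted x \<le> 1"
proof -
  have "boosted_stay x + plain_to_boosted x = (1 - x) * (1 + x/2 + 3/20 * x^2)"
    by (simp add: boosted_stay_def plain_to_boosted_def power2_eq_square field_simps)
  also have "\<dots> = 1 - (x/2 + 7/20 * x^2 + 3/20 * x^3)"
    by (simp add: power2_eq_square power3_eq_cube field_simps)
  also have "\<dots> \<le> 1" using zero_le_power[OF assms(1), of 2] zero_le_power[OF assms(1), of 3] assms by linarith
  finally show ?thesis .
qed

text \<open>
  The dual weights of the two states are \<open>1147/2000\<close> and \<open>909/2000\<close>. Their mean, the value of a fresh
  level, is \<open>257/500 = 0.514\<close>; \<open>853/2000\<close> and \<open>1091/2000\<close> are their complements to \<open>1\<close>.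
\<close>

lemma dual_row_boosted:
  assumes "0 \<le> x" "0 \<le> d" "d \<le> 1/1000" "x + d \<le> 1"
  shows "d * (1147/2000 * boosted_stay x) \<le> 853/2000 * (boosted_stay x - boosted_stay (x + d))"
proof -
  have x: "x \<le> 1" using assms by simp
  have "853/2000 * (boosted_stay x - boosted_stay (x + d)) - d * (1147/2000 * boosted_stay x)
    = d * (853/2000 * (27/20 - 37/20 * x + 69/40 * x^2 + (- 37/40 + 69/40 * x + 23/40 * d) * d)
       - 1147/2000 * (1 - 27/20 * x + 37/40 * x^2 - 23/40 * x^3))"
    by (simp add: boosted_stay_def power2_eq_square power3_eq_cube field_simps)
  also have "\<dots> \<ge> 0"
  proof (rule mult_nonneg_nonneg)
    define q where "q = (- 37/40 + 69/40 * x + 23/40 * d) * d"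
    have "(- 1) * d \<le> (- 37/40 + 69/40 * x + 23/40 * d) * d" using assms by (intro mult_right_mono) auto
    then have 1: "- 1 * d \<le> q" by (simp add: q_def)
    have 2: "0 \<le> x^3" using assms by simp
    \<comment> \<open>A multiple of this square pays for the term \<open>- 37/2500 * x\<close>
      below. The rest of the constant term bears the discretization error
      \<open>q \<ge> - d\<close>.\<close>
    have 3: "0 \<le> 1/1000 - 1/50 * x + 1/10 * x^2"
    proof -
      have "0 \<le> (x - 1/10)^2" by simp
      then show ?thesis by (simp add: power2_eq_square algebra_simps)
    qed
    have 4: "0 \<le> x^2" by simp
    show "0 \<le> 853/2000 * (27/20 - 37/20 * x + 69/40 * x^2 + (- 37/40 + 69/40 * x + 23/40 * d) * d)
       - 1147/2000 * (1 - 27/20 * x + 37/40 * x^2 - 23/40 * x^3)"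
    proof -
      have "853/2000 * (27/20 - 37/20 * x + 69/40 * x^2 + q) - 1147/2000 * (1 - 27/20 * x + 37/40 * x^2 - 23/40 * x^3)
        = 91/40000 - 37/2500 * x + 8209/40000 * x^2 + 26381/80000 * x^3 + 853/2000 * q"
        by (simp add: field_simps)
      then show ?thesis unfolding q_def[symmetric] using 1 2 3 4 assms by linarith
    qed
  qed (use assms in simp)
  finally show ?thesis by simp
qed

lemma dual_row_plain:
  assumes "0 \<le> x" "0 \<le> d" "d \<le> 1/1000" "x + d \<le> 1"
  shows "d * (909/2000 * plain_stay x + 1147/2000 * plain_to_boosted x)
    \<le> 1091/2000 * (plain_stay x - plain_stay (x + d)) + 853/2000 * (plain_to_boosted x - plain_to_boosted (x + d))"
proof -
  have "1091/2000 * (plain_stay x - plain_stay (x + d)) + 853/2000 * (plain_to_boosted x - plain_to_boosted (x + d))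
      - d * (909/2000 * plain_stay x + 1147/2000 * plain_to_boosted x)
    = d * ((49/40000 - 6683/80000 * d) + 2773/16000 * d^2 + 17/625 * x + 8319/16000 * (x * d)
       + 29139/40000 * x^2 + 827/16000 * x^3)"
    by (simp add: plain_stay_def plain_to_boosted_def power2_eq_square power3_eq_cube field_simps)
  \<comment> \<open>The bound \<open>d \<le> 1/1000\<close> keeps the first bracket
    nonnegative.\<close>
  also have "\<dots> \<ge> 0" using assms by (intro mult_nonneg_nonneg add_nonneg_nonneg) auto
  finally show ?thesis by simp
qed

lemma boosted_stay_antimono:
  assumes "0 \<le> x" "x \<le> y" "y \<le> 1" shows "boosted_stay y \<le> boosted_stay x"
proof -
  have "boosted_stay x - boosted_stay y = (y - x) * ((27/20 - 37/40 * x - 37/40 * y + 23/40 * (x^2 + y^2)) + 23/40 * (x * y))"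
    by (simp add: boosted_stay_def power2_eq_square field_simps)
  also have "\<dots> \<ge> 0"
  proof -
    have "0 \<le> (1 - x)^2 + (1 - y)^2" by simp
    then have "0 \<le> 27/20 - 37/40 * x - 37/40 * y + 23/40 * (x^2 + y^2)"
      using assms by (simp add: power2_eq_square field_simps)
    moreover have "0 \<le> 23/40 * (x * y)" using assms by simp
    ultimately show ?thesis using assms by (intro mult_nonneg_nonneg) linarith+
  qed
  finally show ?thesis by simp
qed

text \<open>\<open>plain_to_boosted\<close> itself increases for small arguments. Its combination
  with \<open>plain_stay\<close> under the dual weights is a polynomial whose coefficients are
  negative apart from the constant one.\<close>

lemma plain_potential_antimono:
  assumes "0 \<le> x" "x \<le> y"
  shows "1147/2000 * plain_to_boosted y + 909/2000 * plain_stay y \<le> 1147/2000 * plain_to_boosted x + 909/2000 * plain_stay x"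
proof -
  have eq: "1147/2000 * plain_to_boosted z + 909/2000 * plain_stay z = 909/2000 - (7771/40000 * z + 16683/80000 * z^2 + 827/16000 * z^3)" for z
    by (simp add: plain_to_boosted_def plain_stay_def power2_eq_square power3_eq_cube field_simps)
  have "x^2 \<le> y^2" "x^3 \<le> y^3" using assms by (auto intro: power_mono)
  then show ?thesis using assms(2) unfolding eq by simp
qed

lemma chain_prob_diff:
  assumes "0 \<le> x" "0 \<le> d" "x + d \<le> 1"
  shows "chain_prob x \<le> chain_prob (x + d)" "chain_prob (x + d) \<le> chain_prob x + d"
proof -
  have eq: "chain_prob (x + d) - chain_prob x = d * (1 - x - d / 2)"
    by (simp add: chain_prob_def power2_eq_square field_simps)
  have "0 \<le> d * (1 - x - d / 2)" using assms by (intro mult_nonneg_nonneg) auto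
  then show "chain_prob x \<le> chain_prob (x + d)" using eq by simp
  have "d * (1 - x - d / 2) \<le> d" using assms mult_left_le[of "1 - x - d / 2" d] by simp
  then show "chain_prob (x + d) \<le> chain_prob x + d" using eq by simp
qed

section \<open>Averages over independent biased bits\<close>

text \<open>The expectation of \<open>g\<close> under a product measure on sets; \<open>e k\<close>
  is the mean of the bit of \<open>k\<close>, encoded as +1 for membership and -1 otherwise. As an
  explicit sum it is a polynomial in the biases, so its identities hold for all real
  \<open>e\<close>.\<close>

definition bias_avg :: "'a set \<Rightarrow> ('a \<Rightarrow> real) \<Rightarrow> ('a set \<Rightarrow> real) \<Rightarrow> real" where
  "bias_avg E e g = (\<Sum>B\<in>Pow E. (\<Prod>k\<in>E. if k \<in> B then (1 + e k) / 2 else (1 - e k) / 2) * g B)"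

lemma bias_avg_insert:
  assumes "finite E" "v \<notin> E"
  shows "bias_avg (insert v E) e g =
    (1 + e v) / 2 * bias_avg E e (\<lambda>B. g (insert v B)) + (1 - e v) / 2 * bias_avg E e g"
proof -
  let ?w = "\<lambda>E B. \<Prod>k\<in>E. if k \<in> B then (1 + e k) / 2 else (1 - e k) / 2"
  have inj: "inj_on (insert v) (Pow E)" using assms(2) by (auto simp: inj_on_def)
  have disj: "Pow E \<inter> insert v ` Pow E = {}" using assms(2) by auto
  have "bias_avg (insert v E) e g = (\<Sum>B\<in>Pow E. ?w (insert v E) B * g B)
      + (\<Sum>B\<in>insert v ` Pow E. ?w (insert v E) B * g B)"
    unfolding bias_avg_def Pow_insert using assms disj by (intro sum.union_disjoint) auto
  also have "(\<Sum>B\<in>insert v ` Pow E. ?w (insert v E) B * g B)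
      = (\<Sum>B\<in>Pow E. ?w (insert v E) (insert v B) * g (insert v B))"
    using inj by (simp add: sum.reindex)
  also have "\<dots> = (\<Sum>B\<in>Pow E. (1 + e v) / 2 * (?w E B * g (insert v B)))"
  proof (intro sum.cong refl)
    fix B assume "B \<in> Pow E"
    have "?w E (insert v B) = ?w E B" using assms by (intro prod.cong) auto
    then show "?w (insert v E) (insert v B) * g (insert v B) = (1 + e v) / 2 * (?w E B * g (insert v B))"
      using assms by simp
  qed
  also have "(\<Sum>B\<in>Pow E. ?w (insert v E) B * g B) = (\<Sum>B\<in>Pow E. (1 - e v) / 2 * (?w E B * g B))"
    using assms by (intro sum.cong refl) auto
  finally show ?thesis by (simp add: bias_avg_def sum_distrib_left)
qed

lemma bias_avg_cong:
  assumes "\<And>k. k \<in> E \<Longrightarrow> e k = e' k" "\<And>B. B \<subseteq> E \<Longrightarrow> g B = g' B"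
  shows "bias_avg E e g = bias_avg E e' g'"
  unfolding bias_avg_def using assms by (intro sum.cong arg_cong2[where f = "(*)"] prod.cong) auto

lemma bias_avg_scale: "bias_avg E e (\<lambda>B. c * g B) = c * bias_avg E e g"
  by (simp add: bias_avg_def sum_distrib_left mult_ac)

lemma bias_avg_add: "bias_avg E e (\<lambda>B. g B + h B) = bias_avg E e g + bias_avg E e h"
  by (simp add: bias_avg_def sum.distrib distrib_left)

lemma bias_avg_sum: "bias_avg E e (\<lambda>B. \<Sum>v\<in>A. g v B) = (\<Sum>v\<in>A. bias_avg E e (g v))"
  by (simp add: bias_avg_def sum_distrib_left sum.swap[of _ A])

lemma bias_avg_one: "finite E \<Longrightarrow> bias_avg E e (\<lambda>_. 1) = 1"
proof (induction E rule: finite_induct)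
  case empty then show ?case by (simp add: bias_avg_def)
next
  case (insert v E) then show ?case by (simp add: bias_avg_insert field_simps)
qed

lemma bias_avg_zero:
  assumes "finite E"
  shows "bias_avg E (\<lambda>_. 0) g = (\<Sum>B\<in>Pow E. g B) / 2 ^ card E"
proof -
  have "(\<Prod>k\<in>E. if k \<in> B then (1 + 0) / 2 else (1 - 0) / 2) = (\<Prod>k\<in>E. 1 / 2 :: real)" for B
    by (intro prod.cong) auto
  then show ?thesis unfolding bias_avg_def by (simp add: sum_divide_distrib power_one_over)
qed

lemma bias_avg_split:
  assumes "finite E" "v \<in> E"
  shows "bias_avg E e g = (1 + e v) / 2 * bias_avg (E - {v}) e (\<lambda>B. g (insert v B))
    + (1 - e v) / 2 * bias_avg (E - {v}) e g"
  using bias_avg_insert[of "E - {v}" v e g] assms by (simp add: insert_absorb)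

lemma bias_avg_del:
  assumes "finite E"
  shows "bias_avg (E - {v}) (e(v := c)) g = bias_avg (E - {v}) e g"
  by (intro bias_avg_cong) auto

lemma bias_avg_plus:
  assumes "finite E" "v \<in> E"
  shows "bias_avg E (e(v := 1)) g = bias_avg (E - {v}) e (\<lambda>B. g (insert v B))"
  by (simp add: bias_avg_split[OF assms] bias_avg_del[OF assms(1)])

lemma bias_avg_minus:
  assumes "finite E" "v \<in> E"
  shows "bias_avg E (e(v := -1)) g = bias_avg (E - {v}) e g"
  by (simp add: bias_avg_split[OF assms] bias_avg_del[OF assms(1)])

text \<open>The average is affine in each bias, so a mixture over the values of one bit is again a
  product average.\<close>

lemma bias_avg_affine:
  assumes "finite E" "v \<in> E"
  shows "bias_avg E (e(v := c)) g = (1 + c) / 2 * bias_avg E (e(v := 1)) g + (1 - c) / 2 * bias_avg E (e(v := -1)) g"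
  unfolding bias_avg_plus[OF assms] bias_avg_minus[OF assms]
  by (simp add: bias_avg_split[OF assms] bias_avg_del[OF assms(1)])

text \<open>A step that resets the bit of \<open>v\<close> with weights depending on that bit alone
  leaves a combination of two product averages in which the bit is fixed.\<close>

lemma bias_avg_update:
  assumes "finite E" "v \<in> E"
  shows "bias_avg E e (\<lambda>B. (if v \<in> B then p else q) * g (B - {v}) + (if v \<in> B then p' else q') * g (insert v B))
   = ((1 + e v) / 2 * p + (1 - e v) / 2 * q) * bias_avg E (e(v := -1)) g
    + ((1 + e v) / 2 * p' + (1 - e v) / 2 * q') * bias_avg E (e(v := 1)) g"
proof -
  have 1: "bias_avg (E - {v}) e (\<lambda>B. (if v \<in> insert v B then p else q) * g (insert v B - {v}) + (if v \<in> insert v B then p' else q') * g (insert v (insert v B)))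
     = bias_avg (E - {v}) e (\<lambda>B. p * g B + p' * g (insert v B))"
    by (intro bias_avg_cong) (auto simp: insert_absorb Diff_insert_absorb subset_Diff_insert)
  have 2: "bias_avg (E - {v}) e (\<lambda>B. (if v \<in> B then p else q) * g (B - {v}) + (if v \<in> B then p' else q') * g (insert v B))
     = bias_avg (E - {v}) e (\<lambda>B. q * g B + q' * g (insert v B))"
    by (intro bias_avg_cong) (auto simp: subset_Diff_insert)
  have "bias_avg E e (\<lambda>B. (if v \<in> B then p else q) * g (B - {v}) + (if v \<in> B then p' else q') * g (insert v B))
    = (1 + e v) / 2 * bias_avg (E - {v}) e (\<lambda>B. p * g B + p' * g (insert v B))
     + (1 - e v) / 2 * bias_avg (E - {v}) e (\<lambda>B. q * g B + q' * g (insert v B))"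
    by (subst bias_avg_split[OF assms], subst 1, subst 2, rule refl)
  then show ?thesis
    unfolding bias_avg_plus[OF assms] bias_avg_minus[OF assms] bias_avg_add bias_avg_scale
    by (simp add: field_simps)
qed

section \<open>The correlated selection step\<close>

text \<open>
  \<open>B\<close> is the set of boosted vertices, those whose bit says that they were passed over at the last use
  of the bit. Two candidates are drawn independently from \<open>p\<close>; the bit of the first one decides between
  them. Replacing the bit by a fair coin with probability \<open>pmf p v / 2\<close> bounds the probability that
  the bit of \<open>v\<close> is used by \<open>1/2\<close>; otherwise a vertex of large mass would flip its bit almost surely,
  and the dual values would not be monotone.
\<close>

definition correlated_choice :: "'a pmf \<Rightarrow> 'a set \<Rightarrow> ('a set \<times> 'a) pmf" where
  "correlated_choice p B =
     bind_pmf p (\<lambda>v. bind_pmf p (\<lambda>r. bind_pmf (bernoulli_pmf (1 - pmf p v / 2)) (\<lambda>c.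
       if c then map_pmf (\<lambda>s. if s then (B - {v}, v) else (insert v B, r))
                   (bernoulli_pmf (if v \<in> B then 17/20 else 3/20))
       else map_pmf (\<lambda>s. (B, if s then v else r)) (bernoulli_pmf (1/2)))))"

definition survives :: "bool \<Rightarrow> 'a \<Rightarrow> 'a \<Rightarrow> real" where
  "survives hit i d = (if hit \<and> d = i then 0 else 1)"

text \<open>The backward operator of one step, with the runs discarded in which \<open>i\<close> is
  selected at a hit.\<close>

definition choice_op :: "'a pmf \<Rightarrow> bool \<Rightarrow> 'a \<Rightarrow> ('a set \<Rightarrow> real) \<Rightarrow> 'a set \<Rightarrow> real" where
  "choice_op p hit i g B =
     measure_pmf.expectation (correlated_choice p B) (\<lambda>(B', d). survives hit i d * g B')"

lemma set_correlated_choice: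
  assumes "(B', d) \<in> set_pmf (correlated_choice p B)"
  shows "d \<in> set_pmf p" "B' \<subseteq> B \<union> set_pmf p"
proof -
  obtain v r c where vr: "v \<in> set_pmf p" "r \<in> set_pmf p"
    and "(B', d) \<in> set_pmf (if c then map_pmf (\<lambda>s. if s then (B - {v}, v) else (insert v B, r))
                   (bernoulli_pmf (if v \<in> B then 17/20 else 3/20))
       else map_pmf (\<lambda>s. (B, if s then v else r)) (bernoulli_pmf (1/2)))"
    using assms unfolding correlated_choice_def set_bind_pmf by blast
  then obtain s where "(B', d) = (if c then (if s then (B - {v}, v) else (insert v B, r)) else (B, if s then v else r))"
    by (cases c) (simp only: if_True if_False set_map_pmf, blast)+
  then show "d \<in> set_pmf p" "B' \<subseteq> B \<union> set_pmf p"
    using vr by (cases c; cases s; auto)+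
qed

lemma finite_correlated_choice: "finite (set_pmf p) \<Longrightarrow> finite (set_pmf (correlated_choice p B))"
  unfolding correlated_choice_def by auto

lemma sum_pmf_survives:
  assumes "finite E" "set_pmf p \<subseteq> E" "i \<in> E"
  shows "(\<Sum>r\<in>E. pmf p r * survives hit i r) = 1 - (if hit then pmf p i else 0)"
proof -
  have "(\<Sum>r\<in>E. pmf p r * survives hit i r) = (\<Sum>r\<in>E. pmf p r - (if r = i then (if hit then pmf p i else 0) else 0))"
    by (intro sum.cong) (auto simp: survives_def)
  also have "\<dots> = 1 - (if hit then pmf p i else 0)"
    using assms by (simp add: sum_subtractf sum_pmf_eq_1)
  finally show ?thesis .
qed

text \<open>The second candidate is independent of the bits and matters only through its survival
  probability \<open>1 - z\<close>, so it is summed out. The weights left in the summand for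
  \<open>v\<close> depend on the bit of \<open>v\<close> alone.\<close>

lemma choice_op_eq:
  fixes hit :: bool
  assumes E: "finite E" "set_pmf p \<subseteq> E" and i: "i \<in> E"
  defines "z \<equiv> (if hit then pmf p i else 0)"
  shows "choice_op p hit i g B = (\<Sum>v\<in>E. pmf p v * (
     (1 - pmf p v / 2) * ((if v \<in> B then 17/20 * survives hit i v else 3/20 * survives hit i v) * g (B - {v})
        + (if v \<in> B then 3/20 * (1 - z) else 17/20 * (1 - z)) * g (insert v B))
     + pmf p v / 2 * ((survives hit i v + (1 - z)) / 2) * g B))"
proof -
  let ?f = "\<lambda>(B', d). survives hit i d * g B'"
  have fin: "finite (set_pmf p)" using E finite_subset by blast
  let ?s = "\<lambda>v. if v \<in> B then 17/20 else 3/20 :: real"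
  have tau: "0 \<le> 1 - pmf p v / 2" "1 - pmf p v / 2 \<le> 1" for v
    using pmf_le_1[of p v] pmf_nonneg[of p v] by linarith+
  have s: "0 \<le> ?s v" "?s v \<le> 1" for v by auto
  have sel: "measure_pmf.expectation (map_pmf (\<lambda>s. if s then (B - {v}, v) else (insert v B, r)) (bernoulli_pmf q)) ?f
      = q * survives hit i v * g (B - {v}) + (1 - q) * survives hit i r * g (insert v B)"
    if "0 \<le> q" "q \<le> 1" for q v r
    using that by (simp add: mult_ac)
  have coin: "measure_pmf.expectation (map_pmf (\<lambda>s. (B, if s then v else r)) (bernoulli_pmf (1/2))) ?f
      = (survives hit i v + survives hit i r) / 2 * g B" for v r
    by (simp add: field_simps)
  have bern: "measure_pmf.expectation (bind_pmf (bernoulli_pmf q) (\<lambda>c. if c then X else Y)) f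
    = q * measure_pmf.expectation X f + (1 - q) * measure_pmf.expectation Y f"
    if "0 \<le> q" "q \<le> 1" "finite (set_pmf X)" "finite (set_pmf Y)"
    for q and X Y :: "('a set \<times> 'a) pmf" and f :: "'a set \<times> 'a \<Rightarrow> real"
    by (subst pmf_expectation_bind[where A = UNIV]) (use that in \<open>auto simp: UNIV_bool\<close>)
  have inner: "measure_pmf.expectation (bind_pmf (bernoulli_pmf (1 - pmf p v / 2)) (\<lambda>c.
       if c then map_pmf (\<lambda>s. if s then (B - {v}, v) else (insert v B, r)) (bernoulli_pmf (?s v))
       else map_pmf (\<lambda>s. (B, if s then v else r)) (bernoulli_pmf (1/2)))) ?f
     = (1 - pmf p v / 2) * (?s v * survives hit i v * g (B - {v}) + (1 - ?s v) * survives hit i r * g (insert v B))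
       + pmf p v / 2 * ((survives hit i v + survives hit i r) / 2 * g B)" for v r
  proof -
    have f: "finite (set_pmf (map_pmf h (bernoulli_pmf q)))" for h :: "bool \<Rightarrow> 'a set \<times> 'a" and q by simp
    show ?thesis unfolding bern[OF tau f f] sel[OF s] coin by simp
  qed
  have "choice_op p hit i g B = (\<Sum>v\<in>E. pmf p v * (\<Sum>r\<in>E. pmf p r *
      ((1 - pmf p v / 2) * (?s v * survives hit i v * g (B - {v}) + (1 - ?s v) * survives hit i r * g (insert v B))
       + pmf p v / 2 * ((survives hit i v + survives hit i r) / 2 * g B))))"
    unfolding choice_op_def correlated_choice_def
    apply (subst pmf_expectation_bind[OF E(1) _ E(2)])
    subgoal using fin by auto
    apply (intro sum.cong refl)
    apply (subst pmf_expectation_bind[OF E(1) _ E(2)])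
    subgoal by auto
    apply (simp only: inner real_scaleR_def)
    done
  also have "\<dots> = (\<Sum>v\<in>E. pmf p v * (
     (1 - pmf p v / 2) * (?s v * survives hit i v * g (B - {v}) + (1 - ?s v) * (1 - z) * g (insert v B))
       + pmf p v / 2 * ((survives hit i v + (1 - z)) / 2 * g B)))"
  proof (intro sum.cong refl arg_cong2[where f = "(*)"])
    fix v
    define s where "s = ?s v"
    \<comment> \<open>The summand is affine in \<open>survives hit i r\<close>: \<open>a\<close> is
      the part free of \<open>r\<close>, and \<open>b\<close> is the coefficient.\<close>
    define a where "a = (1 - pmf p v / 2) * (s * survives hit i v * g (B - {v})) + pmf p v / 2 * (survives hit i v / 2 * g B)"
    define b where "b = (1 - pmf p v / 2) * ((1 - s) * g (insert v B)) + pmf p v / 2 * (g B / 2)"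
    have "(\<Sum>r\<in>E. pmf p r * ((1 - pmf p v / 2) * (s * survives hit i v * g (B - {v}) + (1 - s) * survives hit i r * g (insert v B))
       + pmf p v / 2 * ((survives hit i v + survives hit i r) / 2 * g B)))
      = (\<Sum>r\<in>E. a * pmf p r + b * (pmf p r * survives hit i r))"
      by (intro sum.cong refl) (simp add: a_def b_def distrib_left distrib_right add_divide_distrib mult_ac)
    also have "\<dots> = a * (\<Sum>r\<in>E. pmf p r) + b * (\<Sum>r\<in>E. pmf p r * survives hit i r)"
      by (simp add: sum.distrib sum_distrib_left)
    also have "\<dots> = a + b * (1 - z)"
      unfolding z_def using E i by (simp add: sum_pmf_eq_1 sum_pmf_survives)
    also have "\<dots> = (1 - pmf p v / 2) * (s * survives hit i v * g (B - {v}) + (1 - s) * (1 - z) * g (insert v B))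
       + pmf p v / 2 * ((survives hit i v + (1 - z)) / 2 * g B)"
      by (simp add: a_def b_def distrib_left distrib_right add_divide_distrib mult_ac)
    finally show "(\<Sum>r\<in>E. pmf p r * ((1 - pmf p v / 2) * (?s v * survives hit i v * g (B - {v}) + (1 - ?s v) * survives hit i r * g (insert v B))
       + pmf p v / 2 * ((survives hit i v + survives hit i r) / 2 * g B))) = (1 - pmf p v / 2) * (?s v * survives hit i v * g (B - {v}) + (1 - ?s v) * (1 - z) * g (insert v B))
       + pmf p v / 2 * ((survives hit i v + (1 - z)) / 2 * g B)"
      unfolding s_def .
  qed
  also have "\<dots> = (\<Sum>v\<in>E. pmf p v * (
     (1 - pmf p v / 2) * ((if v \<in> B then 17/20 * survives hit i v else 3/20 * survives hit i v) * g (B - {v})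
        + (if v \<in> B then 3/20 * (1 - z) else 17/20 * (1 - z)) * g (insert v B))
     + pmf p v / 2 * ((survives hit i v + (1 - z)) / 2) * g B))"
  proof (intro sum.cong refl arg_cong2[where f = "(*)"])
    fix v
    show "(1 - pmf p v / 2) * (?s v * survives hit i v * g (B - {v}) + (1 - ?s v) * (1 - z) * g (insert v B))
       + pmf p v / 2 * ((survives hit i v + (1 - z)) / 2 * g B)
      = (1 - pmf p v / 2) * ((if v \<in> B then 17/20 * survives hit i v else 3/20 * survives hit i v) * g (B - {v})
        + (if v \<in> B then 3/20 * (1 - z) else 17/20 * (1 - z)) * g (insert v B))
     + pmf p v / 2 * ((survives hit i v + (1 - z)) / 2) * g B"
      by (cases "v \<in> B") simp_all
  qed
  finally show ?thesis .
qed

text \<open>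
  An upper bound for the mean of \<open>g\<close> under every product distribution of the bits. Since a step that
  samples \<open>v\<close> changes the distribution of the bit of \<open>v\<close> only, this property is passed back through
  a step; knowing the mean of \<open>g\<close> at deterministic bits would not suffice.
\<close>

definition test_bound :: "'a set \<Rightarrow> 'a \<Rightarrow> ('a set \<Rightarrow> real) \<Rightarrow> real \<Rightarrow> real \<Rightarrow> bool" where
  "test_bound E i g RB RP \<longleftrightarrow> (\<forall>e. (\<forall>k\<in>E. \<bar>e k\<bar> \<le> 1) \<longrightarrow>
     bias_avg E e g \<le> ((1 + e i) / 2 * RB + (1 - e i) / 2 * RP) * (\<Prod>k\<in>E - {i}. bias_factor (e k)))"

section \<open>Passing the bound back through one step\<close>

lemma bias_factor_ge_1: "1 \<le> bias_factor e" by (simp add: bias_factor_def)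

text \<open>A first candidate \<open>v\<close> other than \<open>i\<close> changes the bias of
  \<open>v\<close> alone: on survival of \<open>i\<close>, an event of mass \<open>A\<close>, it
  becomes \<open>d / A\<close>, and \<open>bias_factor_step\<close> restores the product of prices
  at the cost \<open>2/5 * z^2\<close>. The fair coin leaves all biases alone and gives the factor
  \<open>1 - z / 2\<close>.\<close>

lemma test_bound_sample_other:
  assumes E: "finite E" "i \<in> E" "v \<in> E" "v \<noteq> i" and g: "test_bound E i g RB RP"
    and R: "0 \<le> RB" "0 \<le> RP" and e: "\<forall>k\<in>E. \<bar>e k\<bar> \<le> 1" and z: "0 \<le> z" "z \<le> 1"
    and tau: "0 \<le> tau" "tau \<le> 1"
  shows "bias_avg E e (\<lambda>B. tau * ((if v \<in> B then 17/20 else 3/20) * g (B - {v})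
        + (if v \<in> B then 3/20 * (1 - z) else 17/20 * (1 - z)) * g (insert v B))
     + (1 - tau) * ((1 + (1 - z)) / 2) * g B)
   \<le> (1 - z / 2 + 2/5 * z^2) * (((1 + e i) / 2 * RB + (1 - e i) / 2 * RP) * (\<Prod>k\<in>E - {i}. bias_factor (e k)))"
proof -
  define own where "own = (1 + e i) / 2 * RB + (1 - e i) / 2 * RP"
  define rest where "rest = (\<Prod>k\<in>E - {i} - {v}. bias_factor (e k))"
  define A where "A = 1 - z / 2 + 7/20 * z * e v"
  define d where "d = - 7/10 * e v * (1 - z / 2) - z / 2"
  have ev: "- 1 \<le> e v" "e v \<le> 1" using e E by (auto simp: abs_le_iff)
  note NS = bias_factor_step[OF z ev, folded A_def d_def]
  have own0: "0 \<le> own" using e E R by (auto simp: own_def abs_le_iff)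
  have rest0: "0 \<le> rest" using bias_factor_ge_1 unfolding rest_def by (intro prod_nonneg) (meson order_trans zero_le_one)
  have prod: "(\<Prod>k\<in>E - {i}. bias_factor (e k)) = bias_factor (e v) * rest"
    unfolding rest_def using E by (intro prod.remove) auto
  have avg: "bias_avg E (e(v := c)) g \<le> own * (bias_factor c * rest)" if "\<bar>c\<bar> \<le> 1" for c
  proof -
    have 1: "(\<Prod>k\<in>E - {i}. bias_factor ((e(v := c)) k)) = bias_factor c * rest"
    proof -
      have "(\<Prod>k\<in>E - {i}. bias_factor ((e(v := c)) k)) = bias_factor c * (\<Prod>k\<in>E - {i} - {v}. bias_factor ((e(v := c)) k))"
        using E by (subst prod.remove[of _ v]) auto
      also have "(\<Prod>k\<in>E - {i} - {v}. bias_factor ((e(v := c)) k)) = rest"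
        unfolding rest_def by (intro prod.cong) auto
      finally show ?thesis .
    qed
    have 2: "\<forall>k\<in>E. \<bar>(e(v := c)) k\<bar> \<le> 1" using e that by auto
    have 3: "(e(v := c)) i = e i" using E by simp
    show ?thesis
      using g[unfolded test_bound_def, rule_format, of "e(v := c)"] 2 unfolding 1 3 own_def by blast
  qed
  have "bias_avg E e (\<lambda>B. (if v \<in> B then 17/20 else 3/20) * g (B - {v})
        + (if v \<in> B then 3/20 * (1 - z) else 17/20 * (1 - z)) * g (insert v B))
     = ((1 + e v) / 2 * (17/20) + (1 - e v) / 2 * (3/20)) * bias_avg E (e(v := -1)) g
      + ((1 + e v) / 2 * (3/20 * (1 - z)) + (1 - e v) / 2 * (17/20 * (1 - z))) * bias_avg E (e(v := 1)) g"
    by (rule bias_avg_update[OF E(1,3)])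
  also have "\<dots> = (A - d) / 2 * bias_avg E (e(v := -1)) g + (A + d) / 2 * bias_avg E (e(v := 1)) g"
    by (intro arg_cong2[where f = "(+)"] arg_cong2[where f = "(*)"] refl) (simp_all add: A_def d_def field_simps)
  \<comment> \<open>The weights \<open>(A - d) / 2\<close> and \<open>(A + d) / 2\<close> are those
    of a bit with mean \<open>d / A\<close>, scaled by \<open>A\<close>.\<close>
  also have "\<dots> = A * bias_avg E (e(v := d / A)) g"
    unfolding bias_avg_affine[OF E(1,3), of e "d / A"] using NS(1) by (simp add: field_simps)
  also have "\<dots> \<le> A * (own * (bias_factor (d / A) * rest))"
    using NS(1,2) avg by (intro mult_left_mono) auto
  also have "\<dots> = (A * bias_factor (d / A)) * (own * rest)" by simp
  also have "\<dots> \<le> ((1 - z / 2 + 2/5 * z^2) * bias_factor (e v)) * (own * rest)"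
    using NS(3) own0 rest0 by (intro mult_right_mono) auto
  finally have chain: "bias_avg E e (\<lambda>B. (if v \<in> B then 17/20 else 3/20) * g (B - {v})
        + (if v \<in> B then 3/20 * (1 - z) else 17/20 * (1 - z)) * g (insert v B))
     \<le> (1 - z / 2 + 2/5 * z^2) * (own * (bias_factor (e v) * rest))" by (simp add: mult_ac)
  have "bias_avg E e g \<le> own * (bias_factor (e v) * rest)" using avg[of "e v"] ev by (simp add: abs_le_iff)
  moreover have "0 \<le> (2/5 * z^2) * (own * (bias_factor (e v) * rest))"
    using own0 rest0 bias_factor_ge_1[of "e v"] by simp
  moreover have "(1 + (1 - z)) / 2 * bias_avg E e g \<le> (1 + (1 - z)) / 2 * (own * (bias_factor (e v) * rest))"
    using calculation(1) z by (intro mult_left_mono) auto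
  ultimately have coin: "(1 + (1 - z)) / 2 * bias_avg E e g \<le> (1 - z / 2 + 2/5 * z^2) * (own * (bias_factor (e v) * rest))"
    by (simp add: field_simps)
  have "tau * bias_avg E e (\<lambda>B. (if v \<in> B then 17/20 else 3/20) * g (B - {v})
        + (if v \<in> B then 3/20 * (1 - z) else 17/20 * (1 - z)) * g (insert v B))
      + (1 - tau) * ((1 + (1 - z)) / 2 * bias_avg E e g)
    \<le> tau * ((1 - z / 2 + 2/5 * z^2) * (own * (bias_factor (e v) * rest)))
      + (1 - tau) * ((1 - z / 2 + 2/5 * z^2) * (own * (bias_factor (e v) * rest)))"
    using chain coin tau by (intro add_mono mult_left_mono) auto
  also have "\<dots> = (1 - z / 2 + 2/5 * z^2) * (own * (bias_factor (e v) * rest))"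
  proof -
    have "tau * X + (1 - tau) * X = X" for X :: real by (simp add: algebra_simps)
    then show ?thesis .
  qed
  finally have fin: "tau * bias_avg E e (\<lambda>B. (if v \<in> B then 17/20 else 3/20) * g (B - {v})
        + (if v \<in> B then 3/20 * (1 - z) else 17/20 * (1 - z)) * g (insert v B))
      + (1 - tau) * ((1 + (1 - z)) / 2 * bias_avg E e g)
    \<le> (1 - z / 2 + 2/5 * z^2) * (own * (bias_factor (e v) * rest))" .
  have eq: "bias_avg E e (\<lambda>B. tau * F B + (1 - tau) * c * g B)
    = tau * bias_avg E e F + (1 - tau) * (c * bias_avg E e g)" for F c
    unfolding bias_avg_add bias_avg_scale by simp
  show ?thesis
    unfolding prod own_def[symmetric] eq by (rule fin)
qed

text \<open>The bit of \<open>i\<close> needs no price, because its two values are tracked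
  separately by \<open>RP\<close> and \<open>RB\<close>; the other biases are untouched.\<close>

lemma test_bound_sample_own:
  assumes E: "finite E" "i \<in> E" and g: "test_bound E i g RB RP"
    and e: "\<forall>k\<in>E. \<bar>e k\<bar> \<le> 1" and tau: "0 \<le> tau" "tau \<le> 1"
    and pos: "0 \<le> p" "0 \<le> q" "0 \<le> p'" "0 \<le> q'" "0 \<le> c"
  shows "bias_avg E e (\<lambda>B. tau * ((if i \<in> B then p else q) * g (B - {i})
        + (if i \<in> B then p' else q') * g (insert i B)) + (1 - tau) * c * g B)
   \<le> (tau * (((1 + e i) / 2 * p + (1 - e i) / 2 * q) * RP + ((1 + e i) / 2 * p' + (1 - e i) / 2 * q') * RB)
      + (1 - tau) * c * ((1 + e i) / 2 * RB + (1 - e i) / 2 * RP)) * (\<Prod>k\<in>E - {i}. bias_factor (e k))"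
proof -
  define rest where "rest = (\<Prod>k\<in>E - {i}. bias_factor (e k))"
  have ei: "- 1 \<le> e i" "e i \<le> 1" using e E by (auto simp: abs_le_iff)
  have avg: "bias_avg E (e(i := y)) g \<le> ((1 + y) / 2 * RB + (1 - y) / 2 * RP) * rest" if "\<bar>y\<bar> \<le> 1" for y
  proof -
    have 1: "(\<Prod>k\<in>E - {i}. bias_factor ((e(i := y)) k)) = rest"
      unfolding rest_def by (intro prod.cong) auto
    have 2: "\<forall>k\<in>E. \<bar>(e(i := y)) k\<bar> \<le> 1" using e that by auto
    have 3: "(e(i := y)) i = y" by simp
    show ?thesis
      using g[unfolded test_bound_def, rule_format, of "e(i := y)"] 2 unfolding 1 3 by blast
  qed
  have m: "bias_avg E (e(i := -1)) g \<le> RP * rest" using avg[of "-1"] by simp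
  have pl: "bias_avg E (e(i := 1)) g \<le> RB * rest" using avg[of 1] by simp
  have s: "bias_avg E e g \<le> ((1 + e i) / 2 * RB + (1 - e i) / 2 * RP) * rest" using avg[of "e i"] ei
    by (simp add: abs_le_iff)
  define a where "a = (1 + e i) / 2 * p + (1 - e i) / 2 * q"
  define b where "b = (1 + e i) / 2 * p' + (1 - e i) / 2 * q'"
  have ab: "0 \<le> a" "0 \<le> b" using ei pos by (auto simp: a_def b_def)
  have "bias_avg E e (\<lambda>B. tau * ((if i \<in> B then p else q) * g (B - {i})
        + (if i \<in> B then p' else q') * g (insert i B)) + (1 - tau) * c * g B)
    = tau * bias_avg E e (\<lambda>B. (if i \<in> B then p else q) * g (B - {i})
        + (if i \<in> B then p' else q') * g (insert i B)) + (1 - tau) * c * bias_avg E e g"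
    unfolding bias_avg_add bias_avg_scale by simp
  also have "\<dots> = tau * (a * bias_avg E (e(i := -1)) g + b * bias_avg E (e(i := 1)) g) + (1 - tau) * c * bias_avg E e g"
    unfolding bias_avg_update[OF E] a_def b_def ..
  also have "\<dots> \<le> tau * (a * (RP * rest) + b * (RB * rest))
      + (1 - tau) * c * (((1 + e i) / 2 * RB + (1 - e i) / 2 * RP) * rest)"
    using m pl s ab tau pos by (intro add_mono mult_left_mono) auto
  also have "\<dots> = (tau * (a * RP + b * RB) + (1 - tau) * c * ((1 + e i) / 2 * RB + (1 - e i) / 2 * RP)) * rest"
    by (simp only: distrib_right distrib_left mult.assoc)
  finally show ?thesis unfolding a_def b_def rest_def .
qed

text \<open>The first component belongs to the boosted state. Without a hit no mass is lost, and the
  bit flips with probability \<open>17/20 * chain_prob x\<close>.\<close>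

definition level_step :: "bool \<Rightarrow> real \<Rightarrow> real \<times> real \<Rightarrow> real \<times> real" where
  "level_step hit x u = (if hit then (boosted_stay x * fst u + plain_to_boosted x * snd u, plain_stay x * snd u)
     else (fst u - 17/20 * chain_prob x * (fst u - snd u), snd u + 17/20 * chain_prob x * (fst u - snd u)))"

text \<open>The cases of the first candidate are averaged. The matrix acting on
  \<open>(RB, RP)\<close> is the transpose of the one in \<open>level_step\<close>: bounds for test
  functions run backwards in time, the pair of probabilities forwards.\<close>

lemma test_bound_choice_op:
  assumes E: "finite E" "set_pmf p \<subseteq> E" "i \<in> E" and g: "test_bound E i g RB RP"
    and R: "0 \<le> RB" "0 \<le> RP"
  defines "x \<equiv> pmf p i"
  shows "test_bound E i (choice_op p hit i g)
    (if hit then boosted_stay x * RB else RB - 17/20 * chain_prob x * (RB - RP))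
    (if hit then plain_stay x * RP + plain_to_boosted x * RB else RP + 17/20 * chain_prob x * (RB - RP))"
  unfolding test_bound_def
proof (intro allI impI)
  fix e :: "'a \<Rightarrow> real" assume e: "\<forall>k\<in>E. \<bar>e k\<bar> \<le> 1"
  define rest where "rest = (\<Prod>k\<in>E - {i}. bias_factor (e k))"
  define own where "own = (1 + e i) / 2 * RB + (1 - e i) / 2 * RP"
  define z where "z = (if hit then x else 0)"
  have x: "0 \<le> x" "x \<le> 1" by (auto simp: x_def pmf_le_1)
  have z: "0 \<le> z" "z \<le> 1" using x by (auto simp: z_def)
  have tau: "0 \<le> 1 - pmf p v / 2" "1 - pmf p v / 2 \<le> 1" for v
    using pmf_le_1[of p v] pmf_nonneg[of p v] by linarith+
  define F where "F v B = (1 - pmf p v / 2) * ((if v \<in> B then 17/20 * survives hit i v else 3/20 * survives hit i v) * g (B - {v})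
        + (if v \<in> B then 3/20 * (1 - z) else 17/20 * (1 - z)) * g (insert v B))
     + pmf p v / 2 * ((survives hit i v + (1 - z)) / 2) * g B" for v B
  have op: "choice_op p hit i g B = (\<Sum>v\<in>E. pmf p v * F v B)" for B
    unfolding F_def z_def x_def by (rule choice_op_eq[OF E])
  have other: "bias_avg E e (F v) \<le> (1 - z / 2 + 2/5 * z^2) * (own * rest)" if "v \<in> E - {i}" for v
  proof -
    have "F v = (\<lambda>B. (1 - pmf p v / 2) * ((if v \<in> B then 17/20 else 3/20) * g (B - {v})
        + (if v \<in> B then 3/20 * (1 - z) else 17/20 * (1 - z)) * g (insert v B))
     + (1 - (1 - pmf p v / 2)) * ((1 + (1 - z)) / 2) * g B)"
      using that by (simp add: F_def survives_def fun_eq_iff)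
    then show ?thesis
      using test_bound_sample_other[OF E(1,3) _ _ g R e z tau, of v v] that
      unfolding own_def rest_def by simp
  qed
  define own' where "own' = (1 - x / 2) * (((1 + e i) / 2 * (17/20 * survives hit i i) + (1 - e i) / 2 * (3/20 * survives hit i i)) * RP
       + ((1 + e i) / 2 * (3/20 * (1 - z)) + (1 - e i) / 2 * (17/20 * (1 - z))) * RB)
      + (1 - (1 - x / 2)) * ((survives hit i i + (1 - z)) / 2) * own"
  have self: "bias_avg E e (F i) \<le> own' * rest"
  proof -
    have "F i = (\<lambda>B. (1 - x / 2) * ((if i \<in> B then 17/20 * survives hit i i else 3/20 * survives hit i i) * g (B - {i})
        + (if i \<in> B then 3/20 * (1 - z) else 17/20 * (1 - z)) * g (insert i B))
     + (1 - (1 - x / 2)) * ((survives hit i i + (1 - z)) / 2) * g B)"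
      by (simp add: F_def x_def fun_eq_iff)
    moreover have "0 \<le> survives hit i i" by (simp add: survives_def)
    ultimately show ?thesis
      unfolding own'_def own_def rest_def
      using test_bound_sample_own[OF E(1,3) g e tau[of i, folded x_def], of "17/20 * survives hit i i" "3/20 * survives hit i i"
         "3/20 * (1 - z)" "17/20 * (1 - z)" "(survives hit i i + (1 - z)) / 2"] z by simp
  qed
  have rem: "(\<Sum>v\<in>E - {i}. pmf p v) = 1 - x"
    using sum_pmf_eq_1[OF E(1,2)] sum.remove[OF E(1,3), of "pmf p"] by (simp add: x_def)
  have "bias_avg E e (choice_op p hit i g) = (\<Sum>v\<in>E. pmf p v * bias_avg E e (F v))"
    unfolding op bias_avg_sum bias_avg_scale ..
  also have "\<dots> = x * bias_avg E e (F i) + (\<Sum>v\<in>E - {i}. pmf p v * bias_avg E e (F v))"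
    unfolding x_def by (rule sum.remove[OF E(1,3)])
  also have "\<dots> \<le> x * (own' * rest) + (\<Sum>v\<in>E - {i}. pmf p v * ((1 - z / 2 + 2/5 * z^2) * (own * rest)))"
    using self other x by (intro add_mono sum_mono mult_left_mono) auto
  also have "\<dots> = x * (own' * rest) + (1 - x) * ((1 - z / 2 + 2/5 * z^2) * (own * rest))"
    by (simp only: sum_distrib_right[symmetric] rem)
  also have "\<dots> = (x * own' + (1 - x) * (1 - z / 2 + 2/5 * z^2) * own) * rest"
    by (simp only: distrib_right mult.assoc)
  also have "x * own' + (1 - x) * (1 - z / 2 + 2/5 * z^2) * own =
     (1 + e i) / 2 * (if hit then boosted_stay x * RB else RB - 17/20 * chain_prob x * (RB - RP))
     + (1 - e i) / 2 * (if hit then plain_stay x * RP + plain_to_boosted x * RB else RP + 17/20 * chain_prob x * (RB - RP))"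
    by (cases hit) (simp_all add: own'_def own_def z_def survives_def boosted_stay_def plain_stay_def plain_to_boosted_def chain_prob_def power2_eq_square field_simps)
  finally show "bias_avg E e (choice_op p hit i g) \<le>
     ((1 + e i) / 2 * (if hit then boosted_stay x * RB else RB - 17/20 * chain_prob x * (RB - RP))
     + (1 - e i) / 2 * (if hit then plain_stay x * RP + plain_to_boosted x * RB else RP + 17/20 * chain_prob x * (RB - RP))) * (\<Prod>k\<in>E - {i}. bias_factor (e k))"
    unfolding rest_def .
qed

section \<open>Runs of the rounding process\<close>

primrec config_run :: "'a set \<Rightarrow> (nat \<Rightarrow> 'a pmf) \<Rightarrow> nat \<Rightarrow> ('a set \<times> 'a list) pmf" where
  "config_run E P 0 = map_pmf (\<lambda>B. (B, [])) (pmf_of_set (Pow E))"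
| "config_run E P (Suc k) = bind_pmf (config_run E P k)
     (\<lambda>(B, ds). map_pmf (\<lambda>(B', d). (B', ds @ [d])) (correlated_choice (P k) B))"

primrec level_run :: "(nat \<Rightarrow> bool) \<Rightarrow> (nat \<Rightarrow> real) \<Rightarrow> nat \<Rightarrow> real \<times> real" where
  "level_run hit x 0 = (1/2, 1/2)"
| "level_run hit x (Suc k) = level_step (hit k) (x k) (level_run hit x k)"

lemma set_config_run:
  assumes "finite E" "\<forall>k. set_pmf (P k) \<subseteq> E" "(B, ds) \<in> set_pmf (config_run E P k)"
  shows "B \<subseteq> E \<and> length ds = k \<and> set ds \<subseteq> E"
  using assms(3)
proof (induction k arbitrary: B ds)
  case 0
  moreover have "Pow E \<noteq> {}" by auto
  ultimately show ?case using assms(1) set_pmf_of_set[of "Pow E"] by auto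
next
  case (Suc k)
  then obtain B0 ds0 B' d where 1: "(B0, ds0) \<in> set_pmf (config_run E P k)"
    and 2: "(B', d) \<in> set_pmf (correlated_choice (P k) B0)" "B = B'" "ds = ds0 @ [d]"
    by auto
  show ?case using Suc.IH[OF 1] set_correlated_choice[OF 2(1)] 2 assms(2) by auto
qed

lemma finite_config_run:
  assumes "finite E" "\<forall>k. set_pmf (P k) \<subseteq> E"
  shows "finite (set_pmf (config_run E P k))"
proof (rule finite_subset)
  show "set_pmf (config_run E P k) \<subseteq> Pow E \<times> {ds. set ds \<subseteq> E \<and> length ds = k}"
    using set_config_run[OF assms] by fast
  show "finite (Pow E \<times> {ds. set ds \<subseteq> E \<and> length ds = k})"
    using assms(1) finite_lists_length_eq by blast
qed

text \<open>The induction lets \<open>g\<close> vary, since the last step is absorbed into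
  \<open>g\<close> by \<open>choice_op\<close>. At the start the bits are uniform, so all biases
  vanish and every price is 1.\<close>

lemma config_run_test_bound:
  fixes hit :: "nat \<Rightarrow> bool"
  assumes E: "finite E" "\<forall>k. set_pmf (P k) \<subseteq> E" "i \<in> E"
    and g: "test_bound E i g RB RP" "0 \<le> RB" "0 \<le> RP"
  defines "u \<equiv> level_run hit (\<lambda>k. pmf (P k) i)"
  shows "measure_pmf.expectation (config_run E P k)
       (\<lambda>(B, ds). (\<Prod>j<k. survives (hit j) i (ds ! j)) * g B) \<le> RB * fst (u k) + RP * snd (u k)"
  using g
proof (induction k arbitrary: g RB RP)
  case 0
  have ne: "Pow E \<noteq> {}" "finite (Pow E)" using E by auto
  have "measure_pmf.expectation (config_run E P 0) (\<lambda>(B, ds). (\<Prod>j<0. survives (hit j) i (ds ! j)) * g B)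
     = bias_avg E (\<lambda>_. 0) g"
    using ne E(1) by (simp add: integral_pmf_of_set bias_avg_zero card_Pow)
  also have "\<dots> \<le> (1 / 2 * RB + 1 / 2 * RP) * (\<Prod>k\<in>E - {i}. bias_factor 0)"
    using 0(1)[unfolded test_bound_def, rule_format, of "\<lambda>_. 0"] by simp
  also have "\<dots> = RB * fst (u 0) + RP * snd (u 0)" by (simp add: bias_factor_def u_def)
  finally show ?case .
next
  case (Suc k)
  define x where "x = pmf (P k) i"
  have x: "0 \<le> x" "x \<le> 1" by (auto simp: x_def pmf_le_1)
  define RB' where "RB' = (if hit k then boosted_stay x * RB else RB - 17/20 * chain_prob x * (RB - RP))"
  define RP' where "RP' = (if hit k then plain_stay x * RP + plain_to_boosted x * RB else RP + 17/20 * chain_prob x * (RB - RP))"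
  have cp: "0 \<le> 17/20 * chain_prob x" "17/20 * chain_prob x \<le> 1"
    using chain_prob_nonneg[OF x] chain_prob_le_half[of x] by auto
  have "RB' = (1 - 17/20 * chain_prob x) * RB + 17/20 * chain_prob x * RP" if "\<not> hit k"
    using that by (simp add: RB'_def field_simps)
  moreover have "RP' = (1 - 17/20 * chain_prob x) * RP + 17/20 * chain_prob x * RB" if "\<not> hit k"
    using that by (simp add: RP'_def field_simps)
  ultimately have R': "0 \<le> RB'" "0 \<le> RP'"
    using cp Suc.prems(2,3) boosted_stay_nonneg[OF x] plain_stay_nonneg[OF x] plain_to_boosted_nonneg[OF x]
    by (cases "hit k"; simp add: RB'_def RP'_def)+
  have g': "test_bound E i (choice_op (P k) (hit k) i g) RB' RP'"
    unfolding RB'_def RP'_def x_def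
    by (rule test_bound_choice_op[OF E(1) E(2)[rule_format] E(3) Suc.prems])
  define S where "S = set_pmf (config_run E P k)"
  have S: "finite S" "set_pmf (config_run E P k) \<subseteq> S" unfolding S_def using finite_config_run[OF E(1,2)] by auto
  have fin: "finite (set_pmf (correlated_choice (P k) B))" for B
    using finite_correlated_choice finite_subset[OF E(2)[rule_format] E(1)] by blast
  let ?h = "\<lambda>(B, ds). (\<Prod>j<Suc k. survives (hit j) i (ds ! j)) * g B"
  have "measure_pmf.expectation (config_run E P (Suc k)) ?h
    = (\<Sum>s\<in>S. pmf (config_run E P k) s * measure_pmf.expectation ((\<lambda>(B, ds). map_pmf (\<lambda>(B', d). (B', ds @ [d])) (correlated_choice (P k) B)) s) ?h)"
    unfolding config_run.simps by (subst pmf_expectation_bind[OF S(1) _ S(2)]) (use fin in \<open>auto split: prod.splits\<close>)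
  also have "\<dots> = (\<Sum>s\<in>S. pmf (config_run E P k) s *
      (\<lambda>(B, ds). (\<Prod>j<k. survives (hit j) i (ds ! j)) * choice_op (P k) (hit k) i g B) s)"
  proof (intro sum.cong refl arg_cong2[where f = "(*)"])
    fix s assume "s \<in> S"
    obtain B ds where s: "s = (B, ds)" by (cases s)
    have len: "length ds = k" using set_config_run[OF E(1,2)] \<open>s \<in> S\<close> unfolding s S_def by blast
    have "measure_pmf.expectation (map_pmf (\<lambda>(B', d). (B', ds @ [d])) (correlated_choice (P k) B)) ?h
       = measure_pmf.expectation (correlated_choice (P k) B)
          (\<lambda>y. (\<Prod>j<k. survives (hit j) i (ds ! j)) * (\<lambda>(B', d). survives (hit k) i d * g B') y)"
      using len by (auto simp: case_prod_unfold nth_append mult_ac intro!: Bochner_Integration.integral_cong)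
    also have "\<dots> = (\<Prod>j<k. survives (hit j) i (ds ! j)) * choice_op (P k) (hit k) i g B"
      unfolding choice_op_def by simp
    finally show "measure_pmf.expectation ((\<lambda>(B, ds). map_pmf (\<lambda>(B', d). (B', ds @ [d])) (correlated_choice (P k) B)) s) ?h
       = (\<lambda>(B, ds). (\<Prod>j<k. survives (hit j) i (ds ! j)) * choice_op (P k) (hit k) i g B) s"
      unfolding s by simp
  qed
  also have "\<dots> = measure_pmf.expectation (config_run E P k)
      (\<lambda>(B, ds). (\<Prod>j<k. survives (hit j) i (ds ! j)) * choice_op (P k) (hit k) i g B)"
    by (subst integral_measure_pmf[OF S(1)]) (auto simp: S_def mult_ac)
  also have "\<dots> \<le> RB' * fst (u k) + RP' * snd (u k)"
    by (rule Suc.IH[OF g' R'])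
  also have "\<dots> = RB * fst (u (Suc k)) + RP * snd (u (Suc k))"
    by (simp add: u_def level_step_def RB'_def RP'_def x_def field_simps)
  finally show ?case .
qed

text \<open>The constant test function 1 is admissible because every price is at least 1.\<close>

corollary config_run_unselected:
  fixes hit :: "nat \<Rightarrow> bool"
  assumes E: "finite E" "\<forall>k. set_pmf (P k) \<subseteq> E" "i \<in> E"
  defines "u \<equiv> level_run hit (\<lambda>k. pmf (P k) i)"
  shows "measure_pmf.prob (config_run E P k) {(B, ds). \<forall>j<k. hit j \<longrightarrow> ds ! j \<noteq> i} \<le> fst (u k) + snd (u k)"
proof -
  have "test_bound E i (\<lambda>_. 1) 1 1"
    unfolding test_bound_def
  proof (intro allI impI)
    fix e :: "'a \<Rightarrow> real"
    have "1 \<le> (\<Prod>k\<in>E - {i}. bias_factor (e k))" using bias_factor_ge_1 by (intro prod_ge_1) auto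
    then show "bias_avg E e (\<lambda>_. 1) \<le> ((1 + e i) / 2 * 1 + (1 - e i) / 2 * 1) * (\<Prod>k\<in>E - {i}. bias_factor (e k))"
      using bias_avg_one[OF E(1), of e] by (simp add: field_simps)
  qed
  from config_run_test_bound[OF E this, where k = k and hit = hit]
  have "measure_pmf.expectation (config_run E P k)
       (\<lambda>(B, ds). (\<Prod>j<k. survives (hit j) i (ds ! j)) * 1) \<le> fst (u k) + snd (u k)"
    by (simp add: u_def)
  also have "(\<lambda>(B, ds). (\<Prod>j<k. survives (hit j) i (ds ! j)) * 1) =
     (indicator {(B :: 'a set, ds). \<forall>j<k. hit j \<longrightarrow> ds ! j \<noteq> i} :: _ \<Rightarrow> real)"
  proof (intro ext, clarify)
    fix B :: "'a set" and ds :: "'a list"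
    have "(\<Prod>j<k. survives (hit j) i (ds ! j)) = (if \<forall>j<k. hit j \<longrightarrow> ds ! j \<noteq> i then 1 else 0)"
      by (auto simp: survives_def prod_zero_iff intro!: prod.neutral)
    then show "(\<Prod>j<k. survives (hit j) i (ds ! j)) * 1 = (indicator {(B :: 'a set, ds). \<forall>j<k. hit j \<longrightarrow> ds ! j \<noteq> i} (B, ds) :: real)"
      by (simp add: indicator_def)
  qed
  finally show ?thesis by simp
qed

section \<open>Weight levels and dual values\<close>

text \<open>The order of the components makes the mixing of the bit increase the dual value. Levels
  beyond \<open>K\<close> are still fresh, which makes the integrals over all levels finite.\<close>

definition level_ok :: "(real \<Rightarrow> real \<times> real) \<Rightarrow> bool" where
  "level_ok u \<longleftrightarrow> (\<lambda>l. fst (u l)) \<in> borel_measurable borel \<and> (\<lambda>l. snd (u l)) \<in> borel_measurable borel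
     \<and> (\<forall>l. 0 \<le> snd (u l) \<and> snd (u l) \<le> fst (u l) \<and> fst (u l) \<le> 1/2)
     \<and> (\<exists>K. \<forall>l>K. u l = (1/2, 1/2))"

definition level_update :: "real \<Rightarrow> real \<Rightarrow> (real \<Rightarrow> real \<times> real) \<Rightarrow> real \<Rightarrow> real \<times> real" where
  "level_update w x u = (\<lambda>l. level_step (l \<le> w) x (u l))"

definition level_int :: "real \<Rightarrow> real \<Rightarrow> real \<Rightarrow> (real \<Rightarrow> real \<times> real) \<Rightarrow> real" where
  "level_int c p q u = (LINT l|lborel. indicator {0<..} l * (c + p * fst (u l) + q * snd (u l)))"

lemma level_ok_init: "level_ok (\<lambda>_. (1/2, 1/2))"
  by (simp add: level_ok_def)

lemma level_step_0: "level_step hit 0 u = u"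
  by (simp add: level_step_def boosted_stay_def plain_stay_def plain_to_boosted_def chain_prob_def)

text \<open>A hit preserves the order by \<open>plain_stay_le_boosted_stay\<close>; mixing preserves
  it because the bit flips with probability at most 1/2.\<close>

lemma level_step_ok:
  assumes x: "0 \<le> x" "x \<le> 1" and u: "0 \<le> b" "b \<le> a" "a \<le> 1/2"
  shows "0 \<le> snd (level_step hit x (a, b))"
    "snd (level_step hit x (a, b)) \<le> fst (level_step hit x (a, b))"
    "fst (level_step hit x (a, b)) \<le> 1/2"
proof -
  note nonneg = boosted_stay_nonneg[OF x] plain_stay_nonneg[OF x] plain_to_boosted_nonneg[OF x]
  have cp: "0 \<le> 17/20 * chain_prob x" "17/20 * chain_prob x \<le> 1/2"
    using chain_prob_nonneg[OF x] chain_prob_le_half[of x] by auto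
  have t: "0 \<le> 17/20 * chain_prob x * (a - b)" using cp u by simp
  have "17/20 * chain_prob x * (a - b) \<le> 1/2 * (a - b)" using cp u by (intro mult_right_mono) auto
  then have t2: "2 * (17/20 * chain_prob x * (a - b)) \<le> a - b" by simp
  have hitT: "level_step True x (a, b) = (boosted_stay x * a + plain_to_boosted x * b, plain_stay x * b)"
    and hitF: "level_step False x (a, b) = (a - 17/20 * chain_prob x * (a - b), b + 17/20 * chain_prob x * (a - b))"
    by (simp_all add: level_step_def)
  have "plain_stay x * b \<le> boosted_stay x * a" using plain_stay_le_boosted_stay[OF x] u nonneg by (intro mult_mono) auto
  moreover have "0 \<le> plain_to_boosted x * b" "0 \<le> plain_stay x * b" using u nonneg by simp_all
  moreover have "boosted_stay x * a + plain_to_boosted x * b \<le> boosted_stay x * (1/2) + plain_to_boosted x * (1/2)"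
    using u nonneg by (intro add_mono mult_left_mono) auto
  moreover have "boosted_stay x * (1/2) + plain_to_boosted x * (1/2) \<le> 1/2" using boosted_stay_plain_to_boosted_le_1[OF x] by simp
  ultimately have T: "0 \<le> plain_stay x * b" "plain_stay x * b \<le> boosted_stay x * a + plain_to_boosted x * b" "boosted_stay x * a + plain_to_boosted x * b \<le> 1/2" by linarith+
  have F: "0 \<le> b + 17/20 * chain_prob x * (a - b)" "b + 17/20 * chain_prob x * (a - b) \<le> a - 17/20 * chain_prob x * (a - b)"
     "a - 17/20 * chain_prob x * (a - b) \<le> 1/2" using t t2 u by linarith+
  show "0 \<le> snd (level_step hit x (a, b))"
    "snd (level_step hit x (a, b)) \<le> fst (level_step hit x (a, b))"
    "fst (level_step hit x (a, b)) \<le> 1/2"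
    using T F by (cases hit; simp only: hitT hitF fst_conv snd_conv)+
qed

lemma level_ok_update:
  assumes u: "level_ok u" and x: "0 \<le> x" "x \<le> 1"
  shows "level_ok (level_update w x u)"
  unfolding level_ok_def
proof (intro conjI allI)
  have [measurable]: "(\<lambda>l. fst (u l)) \<in> borel_measurable borel" "(\<lambda>l. snd (u l)) \<in> borel_measurable borel"
    using u unfolding level_ok_def by blast+
  have "(\<lambda>l. fst (level_update w x u l)) = (\<lambda>l. if l \<le> w then boosted_stay x * fst (u l) + plain_to_boosted x * snd (u l)
      else fst (u l) - 17/20 * chain_prob x * (fst (u l) - snd (u l)))"
    by (simp add: level_update_def level_step_def fun_eq_iff)
  then show "(\<lambda>l. fst (level_update w x u l)) \<in> borel_measurable borel" by simp
  have "(\<lambda>l. snd (level_update w x u l)) = (\<lambda>l. if l \<le> w then plain_stay x * snd (u l)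
      else snd (u l) + 17/20 * chain_prob x * (fst (u l) - snd (u l)))"
    by (simp add: level_update_def level_step_def fun_eq_iff)
  then show "(\<lambda>l. snd (level_update w x u l)) \<in> borel_measurable borel" by simp
  fix l
  have "0 \<le> snd (u l)" "snd (u l) \<le> fst (u l)" "fst (u l) \<le> 1/2" using u by (auto simp: level_ok_def)
  from level_step_ok[OF x this, of "l \<le> w"]
  show "0 \<le> snd (level_update w x u l)" "snd (level_update w x u l) \<le> fst (level_update w x u l)"
    "fst (level_update w x u l) \<le> 1/2"
    by (simp_all add: level_update_def)
next
  obtain K where K: "\<And>l. l > K \<Longrightarrow> u l = (1/2, 1/2)" using u by (auto simp: level_ok_def)
  then show "\<exists>K. \<forall>l>K. level_update w x u l = (1/2, 1/2)"
    by (intro exI[of _ "max K w"]) (auto simp: level_update_def level_step_def)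
qed

text \<open>The condition on \<open>c\<close>, \<open>p\<close> and \<open>q\<close> says that a
  fresh level contributes 0, so the integrand is bounded and has bounded support.\<close>

lemma integrable_level:
  assumes u: "level_ok u" and z: "c + p / 2 + q / 2 = 0"
  shows "integrable lborel (\<lambda>l. indicator {0<..} l * (c + p * fst (u l) + q * snd (u l)))"
proof -
  obtain K where K: "\<And>l. l > K \<Longrightarrow> u l = (1/2, 1/2)" using u by (auto simp: level_ok_def)
  have [measurable]: "(\<lambda>l. fst (u l)) \<in> borel_measurable borel" "(\<lambda>l. snd (u l)) \<in> borel_measurable borel"
    using u unfolding level_ok_def by blast+
  have "integrable lborel (\<lambda>l. indicator {0<..K} l *\<^sub>R (\<bar>c\<bar> + \<bar>p\<bar> + \<bar>q\<bar>))"
    by (cases "0 \<le> K") (auto intro!: integrable_scaleR_left integrable_real_indicator)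
  then show ?thesis
  proof (rule Bochner_Integration.integrable_bound)
    show "(\<lambda>l. indicator {0<..} l * (c + p * fst (u l) + q * snd (u l))) \<in> borel_measurable lborel"
      by measurable
    show "AE l in lborel. norm (indicator {0<..} l * (c + p * fst (u l) + q * snd (u l)))
        \<le> norm (indicator {0<..K} l *\<^sub>R (\<bar>c\<bar> + \<bar>p\<bar> + \<bar>q\<bar>))"
    proof (rule AE_I2)
      fix l
      have b: "0 \<le> snd (u l)" "snd (u l) \<le> fst (u l)" "fst (u l) \<le> 1/2" using u by (auto simp: level_ok_def)
      have "\<bar>c + p * fst (u l) + q * snd (u l)\<bar> \<le> \<bar>c\<bar> + \<bar>p\<bar> * \<bar>fst (u l)\<bar> + \<bar>q\<bar> * \<bar>snd (u l)\<bar>"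
        by (simp add: abs_mult[symmetric])
      also have "\<dots> \<le> \<bar>c\<bar> + \<bar>p\<bar> * 1 + \<bar>q\<bar> * 1"
        using b by (intro add_mono mult_left_mono order_refl) auto
      finally have 1: "\<bar>c + p * fst (u l) + q * snd (u l)\<bar> \<le> \<bar>c\<bar> + \<bar>p\<bar> + \<bar>q\<bar>" by simp
      have 2: "c + p * fst (u l) + q * snd (u l) = 0" if "l > K" using K[OF that] z by simp
      show "norm (indicator {0<..} l * (c + p * fst (u l) + q * snd (u l)))
        \<le> norm (indicator {0<..K} l *\<^sub>R (\<bar>c\<bar> + \<bar>p\<bar> + \<bar>q\<bar>))"
        using 1 2 by (cases "l > K") (auto simp: indicator_def)
    qed
  qed
qed

lemma level_int_diff:
  assumes "level_ok u" "c + p / 2 + q / 2 = 0" "c' + p' / 2 + q' / 2 = 0"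
  shows "level_int c p q u - level_int c' p' q' u = level_int (c - c') (p - p') (q - q') u"
proof -
  have "level_int c p q u - level_int c' p' q' u
    = (LINT l|lborel. indicator {0<..} l * (c + p * fst (u l) + q * snd (u l)) - indicator {0<..} l * (c' + p' * fst (u l) + q' * snd (u l)))"
    unfolding level_int_def
    by (rule Bochner_Integration.integral_diff[symmetric]; rule integrable_level; fact)
  also have "\<dots> = level_int (c - c') (p - p') (q - q') u"
    unfolding level_int_def by (intro Bochner_Integration.integral_cong) (auto simp: algebra_simps)
  finally show ?thesis .
qed

section \<open>Primal and dual values\<close>

definition dual_value :: "(real \<Rightarrow> real \<times> real) \<Rightarrow> real" where
  "dual_value = level_int (257/500) (- 1147/2000) (- 909/2000)"

text \<open>The integrand is a lower bound for the probability that the vertex holds an edge of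
  weight at least \<open>l\<close>, so the integral is a guaranteed part of its expected
  maximum.\<close>

definition primal_value :: "(real \<Rightarrow> real \<times> real) \<Rightarrow> real" where
  "primal_value = level_int 1 (- 1) (- 1)"

definition bid :: "(real \<Rightarrow> real \<times> real) \<Rightarrow> real \<Rightarrow> nat \<Rightarrow> real" where
  "bid u w n = 257/500 * w - dual_value (level_update w (real n / 1000) u)"

text \<open>The comparison is pointwise in the level. At a hit the dual-weighted coefficients of
  both components decrease with the mass; otherwise a larger mass moves more from the boosted to the
  plain state, which has the smaller dual weight.\<close>

lemma dual_value_step:
  assumes u: "level_ok u" and x: "0 \<le> x" "x \<le> y" "y \<le> 1"
  shows "dual_value (level_update w x u) \<le> dual_value (level_update w y u)"
  unfolding dual_value_def level_int_def
proof (rule integral_mono)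
  have x1: "x \<le> 1" "0 \<le> y" using x by auto
  show "integrable lborel (\<lambda>l. indicator {0<..} l * (257/500 + - 1147/2000 * fst (level_update w x u l) + - 909/2000 * snd (level_update w x u l)))"
    by (rule integrable_level[OF level_ok_update[OF u x(1) x1(1)]]) simp
  show "integrable lborel (\<lambda>l. indicator {0<..} l * (257/500 + - 1147/2000 * fst (level_update w y u l) + - 909/2000 * snd (level_update w y u l)))"
    by (rule integrable_level[OF level_ok_update[OF u x1(2) x(3)]]) simp
  fix l
  have b: "0 \<le> snd (u l)" "snd (u l) \<le> fst (u l)" "fst (u l) \<le> 1/2" using u by (auto simp: level_ok_def)
  have "257/500 + - 1147/2000 * fst (level_update w x u l) + - 909/2000 * snd (level_update w x u l)
     \<le> 257/500 + - 1147/2000 * fst (level_update w y u l) + - 909/2000 * snd (level_update w y u l)"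
  proof (cases "l \<le> w")
    case True
    have "boosted_stay y * fst (u l) \<le> boosted_stay x * fst (u l)"
      using boosted_stay_antimono[OF x] b by (intro mult_right_mono) auto
    moreover have "(1147/2000 * plain_to_boosted y + 909/2000 * plain_stay y) * snd (u l) \<le> (1147/2000 * plain_to_boosted x + 909/2000 * plain_stay x) * snd (u l)"
      using plain_potential_antimono[OF x(1,2)] b by (intro mult_right_mono) auto
    ultimately show ?thesis using True by (simp add: level_update_def level_step_def field_simps)
  next
    case False
    have "chain_prob x \<le> chain_prob y" using chain_prob_diff(1)[of x "y - x"] x by simp
    then have "17/20 * chain_prob x * (fst (u l) - snd (u l)) \<le> 17/20 * chain_prob y * (fst (u l) - snd (u l))"
      using b by (intro mult_right_mono) auto
    moreover define s where "s = 17/20 * chain_prob x * (fst (u l) - snd (u l))"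
    moreover define t where "t = 17/20 * chain_prob y * (fst (u l) - snd (u l))"
    ultimately have "s \<le> t" by simp
    moreover have "level_update w x u l = (fst (u l) - s, snd (u l) + s)" "level_update w y u l = (fst (u l) - t, snd (u l) + t)"
      using False by (simp_all add: level_update_def level_step_def s_def t_def)
    ultimately show ?thesis by (simp add: field_simps)
  qed
  then show "indicator {0<..} l * (257/500 + - 1147/2000 * fst (level_update w x u l) + - 909/2000 * snd (level_update w x u l))
     \<le> indicator {0<..} l * (257/500 + - 1147/2000 * fst (level_update w y u l) + - 909/2000 * snd (level_update w y u l))"
    by (intro mult_left_mono) auto
qed

lemma level_update_0: "level_update w 0 u = u"
  by (simp add: level_update_def level_step_0)

lemma dual_value_mono:
  assumes "level_ok u" "0 \<le> x" "x \<le> 1"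
  shows "dual_value u \<le> dual_value (level_update w x u)"
  using dual_value_step[of u 0 x w] assms by (simp add: level_update_0)

lemma bid_antimono:
  assumes "level_ok u" "Suc n \<le> 1000"
  shows "bid u w (Suc n) \<le> bid u w n"
  using dual_value_step[OF assms(1), of "real n / 1000" "real (Suc n) / 1000" w] assms(2)
  by (simp add: bid_def field_simps)

text \<open>At a hit both sides are linear in \<open>(a, b)\<close>, and
  \<open>dual_row_boosted\<close> and \<open>dual_row_plain\<close> compare the coefficients.
  Without a hit the primal integrand is constant, and the growth of the dual one through mixing is
  paid by the negative contribution of the level to the bid.\<close>

lemma level_step_gain:
  fixes hit :: bool
  assumes x: "0 \<le> x" "0 \<le> d" "d \<le> 1/1000" "x + d \<le> 1" and u: "0 \<le> b" "b \<le> a" "a \<le> 1/2"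
  defines "v \<equiv> level_step hit x (a, b)" and "v' \<equiv> level_step hit (x + d) (a, b)"
  shows "d * (257/500 * of_bool hit - (257/500 + - 1147/2000 * fst v + - 909/2000 * snd v))
    \<le> 853/2000 * (fst v - fst v') + 1091/2000 * (snd v - snd v')"
proof (cases hit)
  case True
  have "d * (1147/2000 * boosted_stay x) * a \<le> 853/2000 * (boosted_stay x - boosted_stay (x + d)) * a"
    using dual_row_boosted[OF x] u by (intro mult_right_mono) auto
  moreover have "d * (909/2000 * plain_stay x + 1147/2000 * plain_to_boosted x) * b
    \<le> (1091/2000 * (plain_stay x - plain_stay (x + d)) + 853/2000 * (plain_to_boosted x - plain_to_boosted (x + d))) * b"
    using dual_row_plain[OF x] u by (intro mult_right_mono) auto
  ultimately show ?thesis using True by (simp add: v_def v'_def level_step_def field_simps)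
next
  case False
  define t where "t = 17/20 * chain_prob x * (a - b)"
  define t' where "t' = 17/20 * chain_prob (x + d) * (a - b)"
  have "(17/20 * (a - b)) * chain_prob (x + d) \<le> (17/20 * (a - b)) * (chain_prob x + d)"
    using chain_prob_diff(2)[OF x(1,2,4)] u by (intro mult_left_mono) auto
  then have tt: "t' - t \<le> d * (17/20 * (a - b))" by (simp add: t_def t'_def field_simps)
  have t0: "0 \<le> t" using u x chain_prob_nonneg[of x] by (simp add: t_def)
  \<comment> \<open>\<open>238/2000\<close> is the difference of the two dual weights. Equality
    holds for a fresh level, \<open>a = b = 1/2\<close>.\<close>
  have "d * (238/2000 * (17/20 * (a - b))) \<le> d * (257/500 - 1147/2000 * a - 909/2000 * b + 238/2000 * t)"
    using x u t0 by (intro mult_left_mono) auto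
  moreover have "v = (a - t, b + t)" "v' = (a - t', b + t')"
    using False by (simp_all add: v_def v'_def level_step_def t_def t'_def)
  moreover have "238/2000 * (t' - t) \<le> 238/2000 * (d * (17/20 * (a - b)))" using tt by simp
  ultimately show ?thesis using False by (simp add: field_simps)
qed

text \<open>This is \<open>level_step_gain\<close> integrated over the levels, with \<open>w\<close>
  as the integral of the indicator of \<open>{0<..w}\<close>: a portion of mass
  \<open>1/1000\<close> pays for the bid made before it was given.\<close>

lemma bid_gain:
  assumes u: "level_ok u" and w: "0 \<le> w" and n: "Suc n \<le> 1000"
  shows "bid u w n / 1000 \<le> (primal_value (level_update w (real (Suc n) / 1000) u) - dual_value (level_update w (real (Suc n) / 1000) u))
     - (primal_value (level_update w (real n / 1000) u) - dual_value (level_update w (real n / 1000) u))"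
proof -
  define x where "x = real n / 1000"
  define v where "v = level_update w x u"
  define v' where "v' = level_update w (x + 1/1000) u"
  have x: "0 \<le> x" "x + 1/1000 \<le> 1" using n by (auto simp: x_def)
  have x1: "x \<le> 1" "0 \<le> x + 1/1000" using x by auto
  have ok: "level_ok v" "level_ok v'" unfolding v_def v'_def
    using level_ok_update[OF u x(1) x1(1)] level_ok_update[OF u x1(2) x(2)] by auto
  have pd: "primal_value y - dual_value y = level_int (243/500) (- 853/2000) (- 1091/2000) y" if "level_ok y" for y
    unfolding primal_value_def dual_value_def by (subst level_int_diff[OF that]) simp_all
  let ?I = "\<lambda>l. indicator {0<..w} l :: real"
  have Iint: "integrable lborel ?I" "(LINT l|lborel. ?I l) = w"
    using w by (auto intro!: integrable_real_indicator)
  let ?D = "\<lambda>l. indicator {0<..} l * (257/500 + - 1147/2000 * fst (v l) + - 909/2000 * snd (v l))"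
  let ?G = "\<lambda>y l. indicator {0<..} l * (243/500 + - 853/2000 * fst (y l) + - 1091/2000 * snd (y l))"
  have Dint: "integrable lborel ?D" by (rule integrable_level[OF ok(1)]) simp
  have Gint: "integrable lborel (?G v)" "integrable lborel (?G v')"
    by (rule integrable_level[OF ok(1)], simp) (rule integrable_level[OF ok(2)], simp)
  have "bid u w n / 1000 = 1/1000 * (257/500 * (LINT l|lborel. ?I l) - (LINT l|lborel. ?D l))"
    unfolding bid_def dual_value_def level_int_def Iint(2) x_def[symmetric] v_def[symmetric] by simp
  also have "\<dots> = (LINT l|lborel. 1/1000 * (257/500 * ?I l - ?D l))"
    using Iint Dint by simp
  also have "\<dots> \<le> (LINT l|lborel. ?G v' l - ?G v l)"
  proof (rule integral_mono)
    show "integrable lborel (\<lambda>l. 1/1000 * (257/500 * ?I l - ?D l))"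
      using Iint(1) Dint by (intro integrable_mult_right Bochner_Integration.integrable_diff)
    show "integrable lborel (\<lambda>l. ?G v' l - ?G v l)"
      using Gint by (intro Bochner_Integration.integrable_diff)
    fix l
    have b: "0 \<le> snd (u l)" "snd (u l) \<le> fst (u l)" "fst (u l) \<le> 1/2" using u by (auto simp: level_ok_def)
    have "1/1000 * (257/500 * of_bool (l \<le> w) - (257/500 + - 1147/2000 * fst (v l) + - 909/2000 * snd (v l)))
       \<le> 853/2000 * (fst (v l) - fst (v' l)) + 1091/2000 * (snd (v l) - snd (v' l))"
      using level_step_gain[of x "1/1000" "snd (u l)" "fst (u l)" "l \<le> w"] x b
      unfolding v_def v'_def level_update_def by simp
    then show "1/1000 * (257/500 * ?I l - ?D l) \<le> ?G v' l - ?G v l"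
      by (auto simp: indicator_def field_simps split: if_splits)
  qed
  also have "\<dots> = (LINT l|lborel. ?G v' l) - (LINT l|lborel. ?G v l)"
    using Gint by simp
  also have "\<dots> = (primal_value v' - dual_value v') - (primal_value v - dual_value v)"
    unfolding pd[OF ok(1)] pd[OF ok(2)] level_int_def ..
  finally show ?thesis
    unfolding v_def v'_def x_def by (simp add: add_divide_distrib add.commute)
qed

lemma sum_bid_gain:
  assumes u: "level_ok u" and w: "0 \<le> w" and n: "n \<le> 1000"
  shows "(\<Sum>l<n. bid u w l) / 1000 \<le> (primal_value (level_update w (real n / 1000) u) - dual_value (level_update w (real n / 1000) u))
     - (primal_value u - dual_value u)"
  using n
proof (induction n)
  case 0 then show ?case by (simp add: level_update_0)
next
  case (Suc n)
  then show ?case using bid_gain[OF u w Suc.prems] by (simp add: add_divide_distrib)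
qed

section \<open>Allocation and the algorithm\<close>

definition slot_count :: "(nat \<Rightarrow> 'v option) \<Rightarrow> nat \<Rightarrow> 'v \<Rightarrow> nat" where
  "slot_count f N i = card {q. q < N \<and> f q = Some i}"

lemma slot_count_le: "slot_count f N i \<le> N"
  unfolding slot_count_def using card_mono[of "{..<N}" "{q. q < N \<and> f q = Some i}"] by auto

lemma slot_count_upd:
  "slot_count (f(N := y)) (Suc N) i = slot_count f N i + (if y = Some i then 1 else 0)"
proof -
  have "{q. q < Suc N \<and> (f(N := y)) q = Some i} = (if y = Some i then insert N {q. q < N \<and> f q = Some i} else {q. q < N \<and> f q = Some i})"
    by (auto simp: less_Suc_eq)
  then show ?thesis by (simp add: slot_count_def)
qed

text \<open>Water filling: each portion goes to a vertex with the highest current bid, or to nobody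
  if no bid is positive. Since bids fall as portions are received, the final maximum
  \<open>\<beta>\<close> is at most every accepted bid.\<close>

lemma greedy_slots:
  fixes b :: "'v \<Rightarrow> nat \<Rightarrow> real"
  assumes L: "finite L" and anti: "\<And>i n. i \<in> L \<Longrightarrow> Suc n \<le> N \<Longrightarrow> b i (Suc n) \<le> b i n"
  shows "k \<le> N \<Longrightarrow> \<exists>f. range f \<subseteq> insert None (Some ` L) \<and>
    (\<exists>\<beta>\<ge>0. (\<forall>i\<in>L. b i (slot_count f k i) \<le> \<beta>) \<and>
       real k * \<beta> \<le> (\<Sum>i\<in>L. \<Sum>l<slot_count f k i. b i l))"
proof -
  define top where "top f k = Max (insert 0 ((\<lambda>i. b i (slot_count f k i)) ` L))" for f k
  have top: "0 \<le> top f k" "\<And>i. i \<in> L \<Longrightarrow> b i (slot_count f k i) \<le> top f k" for f k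
    using L unfolding top_def by auto
  have "k \<le> N \<Longrightarrow> \<exists>f. range f \<subseteq> insert None (Some ` L) \<and>
       real k * top f k \<le> (\<Sum>i\<in>L. \<Sum>l<slot_count f k i. b i l)"
  proof (induction k)
    case 0
    show ?case by (intro exI[of _ "\<lambda>_. None"]) (simp add: slot_count_def)
  next
    case (Suc k)
    then obtain f where f: "range f \<subseteq> insert None (Some ` L)"
      and le: "real k * top f k \<le> (\<Sum>i\<in>L. \<Sum>l<slot_count f k i. b i l)" by auto
    show ?case
    proof (cases "top f k = 0")
      case True
      have c: "slot_count (f(k := None)) (Suc k) i = slot_count f k i" for i by (simp add: slot_count_upd)
      have "top (f(k := None)) (Suc k) = 0" using True unfolding top_def c by simp
      moreover have "range (f(k := None)) \<subseteq> insert None (Some ` L)" using f by auto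
      moreover have "real (Suc k) * top (f(k := None)) (Suc k) \<le> (\<Sum>i\<in>L. \<Sum>l<slot_count (f(k := None)) (Suc k) i. b i l)"
        unfolding c using le True calculation(1) by simp
      ultimately show ?thesis by blast
    next
      case False
      have "top f k \<in> insert 0 ((\<lambda>i. b i (slot_count f k i)) ` L)"
        unfolding top_def using L by (intro Max_in) auto
      then obtain i0 where i0: "i0 \<in> L" "b i0 (slot_count f k i0) = top f k" using False by auto
      let ?f = "f(k := Some i0)"
      have c: "slot_count ?f (Suc k) i = (if i = i0 then Suc (slot_count f k i) else slot_count f k i)" for i
        by (simp add: slot_count_upd)
      have "top ?f (Suc k) \<le> top f k"
      proof -
        have "b i (slot_count ?f (Suc k) i) \<le> top f k" if "i \<in> L" for i
        proof -
          have "Suc (slot_count f k i) \<le> N" using slot_count_le[of f k i] Suc.prems by simp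
          then have "b i (Suc (slot_count f k i)) \<le> top f k" using anti[OF that] top(2)[OF that, of f k] by fastforce
          then show ?thesis using top(2)[OF that, of f k] unfolding c by auto
        qed
        then show ?thesis unfolding top_def[of ?f] using L top(1)[of f k] by auto
      qed
      then have "real (Suc k) * top ?f (Suc k) \<le> real (Suc k) * top f k" by (intro mult_left_mono) auto
      also have "\<dots> = real k * top f k + b i0 (slot_count f k i0)" using i0 by (simp add: algebra_simps)
      also have "\<dots> \<le> (\<Sum>i\<in>L. \<Sum>l<slot_count f k i. b i l) + b i0 (slot_count f k i0)" using le by simp
      also have "\<dots> = (\<Sum>i\<in>L. (\<Sum>l<slot_count f k i. b i l) + (if i = i0 then b i0 (slot_count f k i0) else 0))"
        using L i0 by (simp add: sum.distrib)
      also have "\<dots> = (\<Sum>i\<in>L. \<Sum>l<slot_count ?f (Suc k) i. b i l)"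
        by (intro sum.cong refl) (simp add: c)
      finally have "real (Suc k) * top ?f (Suc k) \<le> (\<Sum>i\<in>L. \<Sum>l<slot_count ?f (Suc k) i. b i l)" .
      moreover have "range ?f \<subseteq> insert None (Some ` L)" using f i0 by auto
      ultimately show ?thesis by blast
    qed
  qed
  then show "k \<le> N \<Longrightarrow> ?thesis" using top by meson
qed

definition slots_ok :: "'v set \<Rightarrow> ('v \<Rightarrow> real \<Rightarrow> real \<times> real) \<Rightarrow> ('v \<Rightarrow> real) \<Rightarrow> (nat \<Rightarrow> 'v option) \<Rightarrow> bool" where
  "slots_ok L U w f \<longleftrightarrow> range f \<subseteq> insert None (Some ` L) \<and>
     (\<exists>\<beta>\<ge>0. (\<forall>i\<in>L. bid (U i) (w i) (slot_count f 1000 i) \<le> \<beta>) \<and>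
       1000 * \<beta> \<le> (\<Sum>i\<in>L. \<Sum>l<slot_count f 1000 i. bid (U i) (w i) l))"

text \<open>The default leaves all portions unassigned, which keeps \<open>set_alloc\<close> free of
  assumptions.\<close>

definition slots :: "'v set \<Rightarrow> ('v \<Rightarrow> real \<Rightarrow> real \<times> real) \<Rightarrow> ('v \<Rightarrow> real) \<Rightarrow> nat \<Rightarrow> 'v option" where
  "slots L U w = (if \<exists>f. slots_ok L U w f then SOME f. slots_ok L U w f else (\<lambda>_. None))"

definition alloc :: "'v set \<Rightarrow> ('v \<Rightarrow> real \<Rightarrow> real \<times> real) \<Rightarrow> ('v \<Rightarrow> real) \<Rightarrow> 'v option pmf" where
  "alloc L U w = map_pmf (slots L U w) (pmf_of_set {..<1000})"

definition levels_step :: "'v set \<Rightarrow> ('v \<Rightarrow> real \<Rightarrow> real \<times> real) \<Rightarrow> ('v \<Rightarrow> real) \<Rightarrow> 'v \<Rightarrow> real \<Rightarrow> real \<times> real" where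
  "levels_step L U w = (\<lambda>i. level_update (w i) (pmf (alloc L U w) (Some i)) (U i))"

text \<open>Nothing here is random: the levels are determined by the weights alone, so the algorithm
  can recompute them from the revealed prefix.\<close>

definition levels :: "'v set \<Rightarrow> ('v \<Rightarrow> real) list \<Rightarrow> 'v \<Rightarrow> real \<Rightarrow> real \<times> real" where
  "levels L ws = foldl (levels_step L) (\<lambda>_ _. (1/2, 1/2)) ws"

lemma slots_ok_exists:
  assumes "finite L" "\<And>i. i \<in> L \<Longrightarrow> level_ok (U i)"
  shows "slots_ok L U w (slots L U w)"
proof -
  have "\<exists>f. slots_ok L U w f"
    unfolding slots_ok_def
    using greedy_slots[of L 1000 "\<lambda>i. bid (U i) (w i)" 1000] bid_antimono assms by simp
  then show ?thesis unfolding slots_def by (simp add: someI_ex)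
qed

lemma set_alloc: "set_pmf (alloc L U w) \<subseteq> insert None (Some ` L)"
proof -
  have "range (slots L U w) \<subseteq> insert None (Some ` L)"
  proof (cases "\<exists>f. slots_ok L U w f")
    case True
    then have "slots_ok L U w (slots L U w)" unfolding slots_def by (simp add: someI_ex)
    then show ?thesis by (simp add: slots_ok_def)
  qed (auto simp: slots_def)
  then show ?thesis unfolding alloc_def by auto
qed

lemma pmf_alloc: "pmf (alloc L U w) (Some i) = real (slot_count (slots L U w) 1000 i) / 1000"
proof -
  have "{..<1000} \<inter> slots L U w -` {Some i} = {q. q < 1000 \<and> slots L U w q = Some i}" by auto
  then show ?thesis
    unfolding alloc_def pmf_map by (subst measure_pmf_of_set) (auto simp: slot_count_def lessThan_empty_iff)
qed

section \<open>Levels along an instance and weak duality\<close>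

lemma levels_snoc: "levels L (ws @ [w]) = levels_step L (levels L ws) w"
  by (simp add: levels_def)

lemma levels_ok: "level_ok (levels L ws i)"
proof (induction ws rule: rev_induct)
  case Nil
  then show ?case by (simp add: levels_def level_ok_init)
next
  case (snoc w ws)
  then show ?case
    unfolding levels_snoc levels_step_def by (intro level_ok_update) (auto simp: pmf_le_1)
qed

text \<open>\<open>\<beta>\<close> is the dual variable of the arriving vertex, namely the final
  water level. No remaining bid exceeds it, which is the dual constraint, and the accepted bids that
  cover \<open>1000 * \<beta>\<close> telescope into the growth of primal minus dual.\<close>

lemma levels_step_dual:
  fixes ws :: "('v \<Rightarrow> real) list" and w :: "'v \<Rightarrow> real"
  assumes L: "finite L" and w: "\<forall>i\<in>L. 0 \<le> w i"
  defines "U \<equiv> levels L ws" and "V \<equiv> levels L (ws @ [w])"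
  shows "\<exists>\<beta>\<ge>0. (\<forall>i\<in>L. 257/500 * w i \<le> dual_value (V i) + \<beta>) \<and>
     (\<Sum>i\<in>L. primal_value (U i) - dual_value (U i)) + \<beta> \<le> (\<Sum>i\<in>L. primal_value (V i) - dual_value (V i))"
proof -
  have ok: "level_ok (U i)" for i unfolding U_def by (rule levels_ok)
  let ?n = "slot_count (slots L U w) 1000"
  obtain \<beta> where b: "\<beta> \<ge> 0" "\<And>i. i \<in> L \<Longrightarrow> bid (U i) (w i) (?n i) \<le> \<beta>"
    "1000 * \<beta> \<le> (\<Sum>i\<in>L. \<Sum>l<?n i. bid (U i) (w i) l)"
    using slots_ok_exists[of L U w, OF L ok] unfolding slots_ok_def by auto
  have V: "V i = level_update (w i) (real (?n i) / 1000) (U i)" for i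
    unfolding V_def levels_snoc levels_step_def pmf_alloc U_def ..
  have "\<beta> \<le> (\<Sum>i\<in>L. (\<Sum>l<?n i. bid (U i) (w i) l) / 1000)"
    using b(3) by (simp add: sum_divide_distrib[symmetric])
  also have "\<dots> \<le> (\<Sum>i\<in>L. (primal_value (V i) - dual_value (V i)) - (primal_value (U i) - dual_value (U i)))"
    unfolding V by (intro sum_mono sum_bid_gain ok w[rule_format] slot_count_le)
  finally have "(\<Sum>i\<in>L. primal_value (U i) - dual_value (U i)) + \<beta> \<le> (\<Sum>i\<in>L. primal_value (V i) - dual_value (V i))"
    by (simp add: sum_subtractf)
  moreover have "257/500 * w i \<le> dual_value (V i) + \<beta>" if "i \<in> L" for i
    using b(2)[OF that] unfolding bid_def V by simp
  ultimately show ?thesis using b(1) by blast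
qed

lemma levels_dual_mono: "dual_value (levels L ws i) \<le> dual_value (levels L (ws @ [w]) i)"
  unfolding levels_snoc levels_step_def by (intro dual_value_mono levels_ok) (auto simp: pmf_le_1)

lemma values_init: "dual_value (\<lambda>_. (1/2, 1/2)) = 0" "primal_value (\<lambda>_. (1/2, 1/2)) = 0"
  by (simp_all add: dual_value_def primal_value_def level_int_def)

lemma levels_dual:
  assumes L: "finite L" and ws: "\<forall>w\<in>set ws. \<forall>i\<in>L. 0 \<le> w i"
  shows "\<exists>\<beta>. (\<forall>j<length ws. 0 \<le> \<beta> j \<and> (\<forall>i\<in>L. 257/500 * (ws ! j) i \<le> dual_value (levels L ws i) + \<beta> j)) \<and>
     (\<forall>i\<in>L. 0 \<le> dual_value (levels L ws i)) \<and>
     (\<Sum>i\<in>L. dual_value (levels L ws i)) + (\<Sum>j<length ws. \<beta> j) \<le> (\<Sum>i\<in>L. primal_value (levels L ws i))"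
  using ws
proof (induction ws rule: rev_induct)
  case Nil
  then show ?case by (simp add: levels_def values_init)
next
  case (snoc w ws)
  have "\<forall>w\<in>set ws. \<forall>i\<in>L. 0 \<le> w i" using snoc.prems by simp
  from snoc.IH[OF this] obtain \<beta> where B: "(\<forall>j<length ws. 0 \<le> \<beta> j \<and> (\<forall>i\<in>L. 257/500 * (ws ! j) i \<le> dual_value (levels L ws i) + \<beta> j)) \<and>
     (\<forall>i\<in>L. 0 \<le> dual_value (levels L ws i)) \<and>
     (\<Sum>i\<in>L. dual_value (levels L ws i)) + (\<Sum>j<length ws. \<beta> j) \<le> (\<Sum>i\<in>L. primal_value (levels L ws i))"
    by blast
  have b: "\<And>j. j < length ws \<Longrightarrow> 0 \<le> \<beta> j"
    "\<And>j i. j < length ws \<Longrightarrow> i \<in> L \<Longrightarrow> 257/500 * (ws ! j) i \<le> dual_value (levels L ws i) + \<beta> j"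
    "\<And>i. i \<in> L \<Longrightarrow> 0 \<le> dual_value (levels L ws i)"
    "(\<Sum>i\<in>L. dual_value (levels L ws i)) + (\<Sum>j<length ws. \<beta> j) \<le> (\<Sum>i\<in>L. primal_value (levels L ws i))"
    using B by blast+
  obtain c where c: "c \<ge> 0" "\<And>i. i \<in> L \<Longrightarrow> 257/500 * w i \<le> dual_value (levels L (ws @ [w]) i) + c"
    "(\<Sum>i\<in>L. primal_value (levels L ws i) - dual_value (levels L ws i)) + c
       \<le> (\<Sum>i\<in>L. primal_value (levels L (ws @ [w]) i) - dual_value (levels L (ws @ [w]) i))"
    using levels_step_dual[OF L, of w ws] snoc.prems by auto
  note mono = levels_dual_mono[of L ws _ w]
  have s: "(\<Sum>j<length (ws @ [w]). (\<beta>(length ws := c)) j) = (\<Sum>j<length ws. \<beta> j) + c" by simp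
  show ?case
  proof (intro exI[of _ "\<beta>(length ws := c)"] conjI allI impI ballI)
    fix j assume "j < length (ws @ [w])"
    then show "0 \<le> (\<beta>(length ws := c)) j" using b(1) c(1) by (cases "j = length ws") auto
    fix i assume i: "i \<in> L"
    show "257/500 * ((ws @ [w]) ! j) i \<le> dual_value (levels L (ws @ [w]) i) + (\<beta>(length ws := c)) j"
    proof (cases "j = length ws")
      case True then show ?thesis using c(2)[OF i] by simp
    next
      case False
      then have "j < length ws" using \<open>j < length (ws @ [w])\<close> by simp
      \<comment> \<open>Constraints of earlier arrivals persist because the dual values of offline
        vertices never decrease.\<close>
      then show ?thesis using b(2)[OF _ i] mono[of i] False by (force simp: nth_append)
    qed
  next
    fix i assume "i \<in> L"
    then show "0 \<le> dual_value (levels L (ws @ [w]) i)" using b(3) mono[of i] by fastforce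
  next
    show "(\<Sum>i\<in>L. dual_value (levels L (ws @ [w]) i)) + (\<Sum>j<length (ws @ [w]). (\<beta>(length ws := c)) j)
       \<le> (\<Sum>i\<in>L. primal_value (levels L (ws @ [w]) i))"
      unfolding s using b(4) c(3) by (simp add: sum_subtractf)
  qed
qed

text \<open>Weak duality: the constraints are summed over an optimal matching, whose edges have
  distinct endpoints, and nonnegativity extends both sums to all vertices.\<close>

lemma primal_ge_opt:
  assumes ok: "instance_ok L ws"
  shows "257/500 * offline_opt L ws \<le> (\<Sum>i\<in>L. primal_value (levels L ws i))"
proof -
  have L: "finite L" and ws: "\<forall>w\<in>set ws. \<forall>i\<in>L. 0 \<le> w i"
    using ok by (auto simp: instance_ok_def)
  let ?M = "{M. is_matching L (length ws) M}"
  have "?M \<subseteq> Pow (L \<times> {..<length ws})" by (auto simp: is_matching_def)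
  then have finM: "finite ?M" using L finite_subset by blast
  have neM: "{} \<in> ?M" by (simp add: is_matching_def)
  have "offline_opt L ws \<in> matching_weight ws ` ?M"
    unfolding offline_opt_def using finM neM by (intro Max_in) auto
  then obtain M where M: "is_matching L (length ws) M" "offline_opt L ws = matching_weight ws M" by auto
  from levels_dual[OF L ws] obtain \<beta> where B: "(\<forall>j<length ws. 0 \<le> \<beta> j \<and> (\<forall>i\<in>L. 257/500 * (ws ! j) i \<le> dual_value (levels L ws i) + \<beta> j)) \<and>
     (\<forall>i\<in>L. 0 \<le> dual_value (levels L ws i)) \<and>
     (\<Sum>i\<in>L. dual_value (levels L ws i)) + (\<Sum>j<length ws. \<beta> j) \<le> (\<Sum>i\<in>L. primal_value (levels L ws i))"
    by blast
  have b: "\<And>j. j < length ws \<Longrightarrow> 0 \<le> \<beta> j"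
    "\<And>j i. j < length ws \<Longrightarrow> i \<in> L \<Longrightarrow> 257/500 * (ws ! j) i \<le> dual_value (levels L ws i) + \<beta> j"
    "\<And>i. i \<in> L \<Longrightarrow> 0 \<le> dual_value (levels L ws i)"
    "(\<Sum>i\<in>L. dual_value (levels L ws i)) + (\<Sum>j<length ws. \<beta> j) \<le> (\<Sum>i\<in>L. primal_value (levels L ws i))"
    using B by blast+
  have MS: "M \<subseteq> L \<times> {..<length ws}" "inj_on fst M" "inj_on snd M" using M by (auto simp: is_matching_def)
  have "257/500 * matching_weight ws M = (\<Sum>e\<in>M. 257/500 * (ws ! snd e) (fst e))"
    by (simp add: matching_weight_def sum_distrib_left case_prod_unfold)
  also have "\<dots> \<le> (\<Sum>e\<in>M. dual_value (levels L ws (fst e)) + \<beta> (snd e))"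
    using MS(1) b(2) by (intro sum_mono) auto
  also have "\<dots> = (\<Sum>i\<in>fst ` M. dual_value (levels L ws i)) + (\<Sum>j\<in>snd ` M. \<beta> j)"
    using MS by (simp add: sum.distrib sum.reindex)
  also have "\<dots> \<le> (\<Sum>i\<in>L. dual_value (levels L ws i)) + (\<Sum>j<length ws. \<beta> j)"
    using MS(1) L b(1,3) by (intro add_mono sum_mono2) auto
  also have "\<dots> \<le> (\<Sum>i\<in>L. primal_value (levels L ws i))" by (rule b(4))
  finally show ?thesis by (simp add: M(2))
qed

section \<open>The algorithm realizes the rounding process\<close>

lemma levels_eq_level_run:
  assumes "k \<le> length ws"
  shows "levels L (take k ws) i l =
     level_run (\<lambda>j. l \<le> (ws ! j) i) (\<lambda>j. pmf (alloc L (levels L (take j ws)) (ws ! j)) (Some i)) k"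
  using assms
proof (induction k)
  case 0 then show ?case by (simp add: levels_def)
next
  case (Suc k)
  then show ?case
    by (simp add: take_Suc_conv_app_nth levels_snoc levels_step_def level_update_def)
qed

text \<open>The signal of a step encodes the set of boosted vertices; initially this set is uniformly random.\<close>

definition rounding_alg :: "('v, nat) online_alg" where
  "rounding_alg L ws h = (let C = Pow (insert None (Some ` L)) in
     bind_pmf (if h = [] then pmf_of_set C else return_pmf (from_nat_into C (fst (last h))))
       (\<lambda>B. map_pmf (\<lambda>(B', d). (to_nat_on C B', d))
          (correlated_choice (alloc L (levels L (butlast ws)) (last ws)) B)))"

lemma valid_rounding_alg: "valid_online_alg rounding_alg"
  unfolding valid_online_alg_def
proof (intro allI impI subsetI)
  fix L :: "'v set" and ws h d
  assume "d \<in> snd ` set_pmf (rounding_alg L ws h)"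
  then obtain x where x: "x \<in> set_pmf (rounding_alg L ws h)" "d = snd x" by blast
  let ?p = "alloc L (levels L (butlast ws)) (last ws)"
  obtain B where "x \<in> set_pmf (map_pmf (\<lambda>(B', d). (to_nat_on (Pow (insert None (Some ` L))) B', d)) (correlated_choice ?p B))"
    using x(1) unfolding rounding_alg_def Let_def set_bind_pmf by blast
  then obtain y where "y \<in> set_pmf (correlated_choice ?p B)" "d = snd y"
    using x(2) by (auto simp only: set_map_pmf snd_conv split: prod.splits)
  then have "d \<in> set_pmf ?p" using set_correlated_choice(1)[of "fst y" "snd y"] by simp
  then show "d \<in> insert None (Some ` L)" using set_alloc by blast
qed

text \<open>Decoding the last signal recovers the boosted vertices, since all reachable sets lie in
  \<open>C\<close>. For the empty history the left side draws the initial set, exactly as the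
  algorithm does in its first step.\<close>

lemma run_steps_config_run:
  fixes L :: "'v set" and ws
  assumes L: "finite L" and k: "k \<le> length ws"
  defines "C \<equiv> Pow (insert None (Some ` L))"
  shows "bind_pmf (run_steps rounding_alg L ws k) (\<lambda>h. map_pmf (\<lambda>B. (B, map snd h))
       (if h = [] then pmf_of_set C else return_pmf (from_nat_into C (fst (last h)))))
     = config_run (insert None (Some ` L)) (\<lambda>j. alloc L (levels L (take j ws)) (ws ! j)) k"
  using k
proof (induction k)
  case 0
  then show ?case by (simp add: bind_return_pmf C_def)
next
  case (Suc k)
  define st where "st h = (if h = [] then pmf_of_set C else return_pmf (from_nat_into C (fst (last h))))"
    for h :: "(nat \<times> 'v option) list"
  define K where "K = correlated_choice (alloc L (levels L (take k ws)) (ws ! k))"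
  have C: "finite C" "C \<noteq> {}" "countable C" using L by (auto simp: C_def countable_finite)
  have st: "B \<in> C" if "B \<in> set_pmf (st h)" for B h
    using that C from_nat_into[OF C(2)] by (auto simp: st_def split: if_splits)
  have dec: "from_nat_into C (to_nat_on C B') = B'" if "B' \<in> C" for B'
    using that C by simp
  have KC: "B' \<in> C" if "B \<in> C" "(B', d) \<in> set_pmf (K B)" for B B' d
    using set_correlated_choice(2)[OF that(2)[unfolded K_def]] that(1)
      set_alloc[of L "levels L (take k ws)" "ws ! k"] unfolding C_def by blast
  have alg: "rounding_alg L (take (Suc k) ws) h = bind_pmf (st h) (\<lambda>B. map_pmf (\<lambda>(B', d). (to_nat_on C B', d)) (K B))" for h
    using Suc.prems unfolding rounding_alg_def Let_def C_def[symmetric] st_def K_def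
    by (simp add: take_Suc_conv_app_nth)
  have "bind_pmf (run_steps rounding_alg L ws (Suc k)) (\<lambda>h. map_pmf (\<lambda>B. (B, map snd h)) (st h))
     = bind_pmf (run_steps rounding_alg L ws k) (\<lambda>h. bind_pmf (st h) (\<lambda>B. bind_pmf (K B)
         (\<lambda>(B', d). return_pmf (from_nat_into C (to_nat_on C B'), map snd h @ [d]))))"
    by (simp add: alg bind_assoc_pmf map_pmf_def bind_return_pmf st_def case_prod_unfold)
  also have "\<dots> = bind_pmf (run_steps rounding_alg L ws k) (\<lambda>h. bind_pmf (st h) (\<lambda>B. bind_pmf (K B)
         (\<lambda>(B', d). return_pmf (B', map snd h @ [d]))))"
  proof (intro bind_pmf_cong refl)
    fix h B y assume "B \<in> set_pmf (st h)" "y \<in> set_pmf (K B)"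
    then have "from_nat_into C (to_nat_on C (fst y)) = fst y"
      using st KC[of B "fst y" "snd y"] by (intro dec) simp
    then show "(case y of (B', d) \<Rightarrow> return_pmf (from_nat_into C (to_nat_on C B'), map snd h @ [d]))
        = (case y of (B', d) \<Rightarrow> return_pmf (B', map snd h @ [d]))"
      by (simp add: case_prod_unfold)
  qed
  also have "\<dots> = bind_pmf (bind_pmf (run_steps rounding_alg L ws k) (\<lambda>h. map_pmf (\<lambda>B. (B, map snd h)) (st h)))
       (\<lambda>(B, ds). map_pmf (\<lambda>(B', d). (B', ds @ [d])) (K B))"
    by (simp add: bind_assoc_pmf map_pmf_def bind_return_pmf case_prod_unfold)
  also have "\<dots> = config_run (insert None (Some ` L)) (\<lambda>j. alloc L (levels L (take j ws)) (ws ! j)) (Suc k)"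
    using Suc.IH Suc.prems unfolding st_def K_def by simp
  finally show ?case unfolding st_def .
qed

lemma decisions_config_run:
  assumes "finite L"
  shows "decisions rounding_alg L ws = map_pmf snd
    (config_run (insert None (Some ` L)) (\<lambda>j. alloc L (levels L (take j ws)) (ws ! j)) (length ws))"
  unfolding run_steps_config_run[OF assms order_refl, symmetric] decisions_def
  by (simp add: map_bind_pmf map_pmf_comp bind_return_pmf' map_pmf_def[of "map snd"])

section \<open>From levels to the expected objective\<close>

lemma Max_layer_cake:
  fixes F :: "real set"
  assumes "finite F"
  shows "integrable lborel (\<lambda>l. indicator {0<..} l * of_bool (\<exists>x\<in>F. l \<le> x) :: real)"
    "Max (insert 0 F) = (LINT l|lborel. indicator {0<..} l * of_bool (\<exists>x\<in>F. l \<le> x))"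
proof -
  define m where "m = Max (insert 0 F)"
  have m0: "0 \<le> m" using assms by (simp add: m_def)
  have "(l \<le> m) \<longleftrightarrow> l \<le> 0 \<or> (\<exists>x\<in>F. l \<le> x)" for l
    unfolding m_def using assms by (subst Max_ge_iff) auto
  then have eq: "(\<lambda>l. indicator {0<..} l * of_bool (\<exists>x\<in>F. l \<le> x) :: real) = indicator {0<..m}"
    by (auto simp: fun_eq_iff indicator_def)
  show "integrable lborel (\<lambda>l. indicator {0<..} l * of_bool (\<exists>x\<in>F. l \<le> x) :: real)"
    unfolding eq using m0 by (intro integrable_real_indicator) auto
  show "Max (insert 0 F) = (LINT l|lborel. indicator {0<..} l * of_bool (\<exists>x\<in>F. l \<le> x))"
    unfolding eq m_def[symmetric] using m0 by simp
qed

text \<open>Finite support allows the expectation and the integral over levels to be exchanged. At a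
  level \<open>l\<close> the failure probability is bounded by \<open>config_run_unselected\<close>,
  where a hit is an edge of weight at least \<open>l\<close>.\<close>

lemma expected_max_ge:
  assumes L: "finite L" "i \<in> L"
  shows "primal_value (levels L ws i) \<le> measure_pmf.expectation (decisions rounding_alg L ws)
     (\<lambda>ds. Max (insert 0 {(ws ! j) i | j. j < length ws \<and> ds ! j = Some i}))"
proof -
  let ?n = "length ws"
  let ?E = "insert None (Some ` L)"
  let ?P = "\<lambda>j. alloc L (levels L (take j ws)) (ws ! j)"
  let ?D = "decisions rounding_alg L ws"
  let ?F = "\<lambda>ds. {(ws ! j) i | j. j < ?n \<and> ds ! j = Some i}"
  let ?f = "\<lambda>ds l. indicator {0<..} l * of_bool (\<exists>x\<in>?F ds. l \<le> x) :: real"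
  let ?u = "levels L ws i"
  have E: "finite ?E" "\<forall>k. set_pmf (?P k) \<subseteq> ?E" "Some i \<in> ?E" using L set_alloc by auto
  have fin: "finite (set_pmf ?D)"
    unfolding decisions_config_run[OF L(1)] using finite_config_run[OF E(1,2)] by simp
  have finF: "finite (?F ds)" for ds by simp
  have int: "integrable lborel (\<lambda>l. pmf ?D ds * ?f ds l)" for ds
    by (intro integrable_mult_right Max_layer_cake(1) finF)
  have exp: "measure_pmf.expectation ?D g = (\<Sum>ds\<in>set_pmf ?D. pmf ?D ds * g ds)" for g :: "'a option list \<Rightarrow> real"
    by (subst integral_measure_pmf[OF fin]) (auto simp: mult_ac)
  have "measure_pmf.expectation ?D (\<lambda>ds. Max (insert 0 (?F ds)))
     = (\<Sum>ds\<in>set_pmf ?D. pmf ?D ds * (LINT l|lborel. ?f ds l))"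
    unfolding exp Max_layer_cake(2)[OF finF] ..
  also have "\<dots> = (LINT l|lborel. (\<Sum>ds\<in>set_pmf ?D. pmf ?D ds * ?f ds l))"
    by (subst Bochner_Integration.integral_sum[OF int]) simp
  finally have eq: "measure_pmf.expectation ?D (\<lambda>ds. Max (insert 0 (?F ds)))
    = (LINT l|lborel. (\<Sum>ds\<in>set_pmf ?D. pmf ?D ds * ?f ds l))" .
  have "primal_value ?u \<le> (LINT l|lborel. (\<Sum>ds\<in>set_pmf ?D. pmf ?D ds * ?f ds l))"
    unfolding primal_value_def level_int_def
  proof (rule integral_mono)
    show "integrable lborel (\<lambda>l. indicator {0<..} l * (1 + - 1 * fst (?u l) + - 1 * snd (?u l)))"
      by (rule integrable_level[OF levels_ok]) simp
    show "integrable lborel (\<lambda>l. \<Sum>ds\<in>set_pmf ?D. pmf ?D ds * ?f ds l)"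
      by (intro Bochner_Integration.integrable_sum int)
    fix l :: real
    define hit where "hit j \<longleftrightarrow> l \<le> (ws ! j) i" for j
    have hit_iff: "(\<exists>x\<in>?F ds. l \<le> x) \<longleftrightarrow> (\<exists>j<?n. hit j \<and> ds ! j = Some i)" for ds
      unfolding hit_def by blast
    define A where "A = {ds. \<exists>j<?n. hit j \<and> ds ! j = Some i}"
    have u: "?u l = level_run hit (\<lambda>j. pmf (?P j) (Some i)) ?n"
      using levels_eq_level_run[of ?n ws L i l] unfolding hit_def by simp
    have "measure_pmf.prob ?D (- A) \<le> fst (?u l) + snd (?u l)"
    proof -
      have "measure_pmf.prob ?D (- A) = measure_pmf.prob (config_run ?E ?P ?n) {(B, ds). \<forall>j<?n. hit j \<longrightarrow> ds ! j \<noteq> Some i}"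
        unfolding decisions_config_run[OF L(1)] measure_map_pmf A_def
        by (intro arg_cong[where f = "measure_pmf.prob _"]) auto
      then show ?thesis using config_run_unselected[OF E, of ?n hit] unfolding u by simp
    qed
    then have "1 - fst (?u l) - snd (?u l) \<le> measure_pmf.prob ?D A"
      using measure_pmf.prob_compl[of A ?D] by (simp add: Compl_eq_Diff_UNIV)
    also have "\<dots> = measure_pmf.expectation ?D (\<lambda>ds. of_bool (\<exists>x\<in>?F ds. l \<le> x))"
    proof -
      have "(\<lambda>ds. of_bool (\<exists>x\<in>?F ds. l \<le> x)) = (indicator A :: _ \<Rightarrow> real)"
        unfolding hit_iff by (simp add: A_def indicator_def fun_eq_iff)
      then show ?thesis by simp
    qed
    also have "\<dots> = (\<Sum>ds\<in>set_pmf ?D. pmf ?D ds * of_bool (\<exists>x\<in>?F ds. l \<le> x))" by (rule exp)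
    finally have "indicator {0<..} l * (1 - fst (?u l) - snd (?u l))
       \<le> indicator {0<..} l * (\<Sum>ds\<in>set_pmf ?D. pmf ?D ds * of_bool (\<exists>x\<in>?F ds. l \<le> x))"
      by (intro mult_left_mono) auto
    also have "\<dots> = (\<Sum>ds\<in>set_pmf ?D. pmf ?D ds * ?f ds l)"
      by (simp add: sum_distrib_left mult_ac)
    finally show "indicator {0<..} l * (1 + - 1 * fst (?u l) + - 1 * snd (?u l))
       \<le> (\<Sum>ds\<in>set_pmf ?D. pmf ?D ds * ?f ds l)" by simp
  qed
  then show ?thesis unfolding eq .
qed

theorem theorem1:
  "\<exists>A :: ('v, nat) online_alg. valid_online_alg A \<and> competitive 0.514 A"
proof (intro exI conjI)
  show "valid_online_alg (rounding_alg :: ('v, nat) online_alg)" by (rule valid_rounding_alg)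
  show "competitive 0.514 (rounding_alg :: ('v, nat) online_alg)"
    unfolding competitive_def
  proof (intro allI impI)
    fix L :: "'v set" and ws
    assume ok: "instance_ok L ws"
    then have L: "finite L" by (simp add: instance_ok_def)
    let ?D = "decisions rounding_alg L ws"
    let ?P = "\<lambda>j. alloc L (levels L (take j ws)) (ws ! j)"
    have E: "finite (insert None (Some ` L))" "\<forall>k. set_pmf (?P k) \<subseteq> insert None (Some ` L)" using L set_alloc by auto
    have fin: "finite (set_pmf ?D)"
      unfolding decisions_config_run[OF L(1)] using finite_config_run[OF E(1,2)] by simp
    have "0.514 * offline_opt L ws \<le> (\<Sum>i\<in>L. primal_value (levels L ws i))"
      using primal_ge_opt[OF ok] by simp
    also have "\<dots> \<le> (\<Sum>i\<in>L. measure_pmf.expectation ?D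
       (\<lambda>ds. Max (insert 0 {(ws ! j) i | j. j < length ws \<and> ds ! j = Some i})))"
      by (intro sum_mono expected_max_ge L)
    also have "\<dots> = measure_pmf.expectation ?D (free_disposal_value L ws)"
      unfolding free_disposal_value_def
      by (intro Bochner_Integration.integral_sum[symmetric] integrable_measure_pmf_finite fin)
    finally show "0.514 * offline_opt L ws \<le> measure_pmf.expectation ?D (free_disposal_value L ws)" .
  qed
qed

end
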